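(* Let $n\ge 2$ be an integer and let $f_n(k)$ be the number of lower $k$-coloured decorated sweep covers in the infinite $n$-ary tree poset (the coefficients of the ordinary generating function $F_n(z)=\sum_{k\ge0} f_n(k)z^k$). Then there is a real constant $D_n > n$ such that \[ f_n(k) = \Theta\left(D_n^k\, k^{-3/2}\right)\qquad (k\to\infty). \]
   Context: In a poset, $p$ covers $q$ if $q<p$ and there is no $r$ with $q<r<p$. The elements covered by $p$ are its children, the elements covering $p$ are its parents, and elements having a common parent are siblings. The infinite $n$-ary tree poset is the poset with a maximum element (the root) $p_0$ whose Hasse diagram is the infinite rooted tree in which every element has exactly $n$ children (equivalently: finite words over an $n$-letter alphabet, with $p\ge q$ iff $p$ is a prefix of $q$). An antichain is a set of pairwise incomparable elements; it is maximal if every element not in it is comparable to at least one of its elements. A decorated sweep cover (DSC) with exactly $k$ colours is a colouring $c:S\to\mathcal K$ of a maximal antichain $S$, using all $k$ colours of a $k$-element set $\mathcal K$, such that any two distinct $p,q\in S$ with $c(p)=c(q)$ are siblings; DSCs are counted up to permutation of the colours (so a $k$-coloured DSC amounts to a maximal antichain $S$ with a partition of $S$ into $k$ nonempty blocks of mutual siblings). A lower DSC is one whose antichain is not the singleton $\{p_0\}$ of the root. The asymptotic $\Theta$ is for fixed $n$, with implied constants depending on $n$. *)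

theory Defs
  imports Complex_Main "HOL-Library.Sublist" "HOL-Library.FuncSet" "HOL-Library.Landau_Symbols"
begin

section \<open>Notions for a poset with carrier \<open>P\<close> and order \<open>le\<close>\<close>

definition covers :: "'a set \<Rightarrow> ('a \<Rightarrow> 'a \<Rightarrow> bool) \<Rightarrow> 'a \<Rightarrow> 'a \<Rightarrow> bool" where
  "covers P le p q \<longleftrightarrow> p \<in> P \<and> q \<in> P \<and> le q p \<and> q \<noteq> p \<and>
     \<not> (\<exists>r\<in>P. le q r \<and> q \<noteq> r \<and> le r p \<and> r \<noteq> p)"

definition siblings :: "'a set \<Rightarrow> ('a \<Rightarrow> 'a \<Rightarrow> bool) \<Rightarrow> 'a \<Rightarrow> 'a \<Rightarrow> bool" where
  "siblings P le p q \<longleftrightarrow> (\<exists>r. covers P le r p \<and> covers P le r q)"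

definition comparable :: "('a \<Rightarrow> 'a \<Rightarrow> bool) \<Rightarrow> 'a \<Rightarrow> 'a \<Rightarrow> bool" where
  "comparable le p q \<longleftrightarrow> le p q \<or> le q p"

definition antichain :: "'a set \<Rightarrow> ('a \<Rightarrow> 'a \<Rightarrow> bool) \<Rightarrow> 'a set \<Rightarrow> bool" where
  "antichain P le S \<longleftrightarrow> S \<subseteq> P \<and> (\<forall>p\<in>S. \<forall>q\<in>S. p \<noteq> q \<longrightarrow> \<not> comparable le p q)"

definition maximal_antichain :: "'a set \<Rightarrow> ('a \<Rightarrow> 'a \<Rightarrow> bool) \<Rightarrow> 'a set \<Rightarrow> bool" where
  "maximal_antichain P le S \<longleftrightarrow>
     antichain P le S \<and> (\<forall>p\<in>P - S. \<exists>q\<in>S. comparable le p q)"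

text \<open>The antichain \<open>S\<close> is kept alongside the colouring, which is extensional on \<open>S\<close>, so that
  equal colourings are equal as HOL functions.\<close>

definition colourings ::
    "'a set \<Rightarrow> ('a \<Rightarrow> 'a \<Rightarrow> bool) \<Rightarrow> 'c set \<Rightarrow> ('a set \<times> ('a \<Rightarrow> 'c)) set" where
  "colourings P le K = {(S, c). maximal_antichain P le S \<and> c \<in> S \<rightarrow>\<^sub>E K \<and> c ` S = K \<and>
     (\<forall>p\<in>S. \<forall>q\<in>S. p \<noteq> q \<and> c p = c q \<longrightarrow> siblings P le p q)}"

definition recolouring :: "'c set \<Rightarrow> (('a set \<times> ('a \<Rightarrow> 'c)) \<times> ('a set \<times> ('a \<Rightarrow> 'c))) set" where
  "recolouring K = {((S, c), (T, d)). S = T \<and>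
     (\<exists>\<pi>. bij_betw \<pi> K K \<and> (\<forall>p\<in>S. d p = \<pi> (c p)))}"


section \<open>The infinite \<open>n\<close>-ary tree poset and its lower decorated sweep covers\<close>

text \<open>Elements are words over \<open>{..<n}\<close>; the root is the empty word and is the maximum, so the
  order is the reverse of the prefix order.\<close>

definition tree :: "nat \<Rightarrow> nat list set" where
  "tree n = lists {..<n}"

definition tree_le :: "nat list \<Rightarrow> nat list \<Rightarrow> bool" where
  "tree_le q p \<longleftrightarrow> prefix p q"

definition lower_colourings :: "nat \<Rightarrow> nat \<Rightarrow> (nat list set \<times> (nat list \<Rightarrow> nat)) set" where
  "lower_colourings n k = {(S, c) \<in> colourings (tree n) tree_le {..<k}. S \<noteq> {[]}}"

text \<open>Decorated sweep covers are classes of colourings modulo permutation of the colours. Every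
  colour class has at most \<open>n\<close> elements (for \<open>n \<ge> 1\<close>), so the antichains involved are
  finite and \<open>card\<close> is applied to a finite set.\<close>

definition num_lower_dsc :: "nat \<Rightarrow> nat \<Rightarrow> nat" where
  "num_lower_dsc n k = card (lower_colourings n k //
     (recolouring {..<k} \<inter> lower_colourings n k \<times> lower_colourings n k))"

end

theory Submission
  imports Defs "HOL-Complex_Analysis.Complex_Analysis" "HOL-Library.Disjoint_Sets"
    "HOL-Real_Asymp.Real_Asymp"
begin

text \<open>Cutting a lower cover below the root gives \<open>F = \<Phi>(z, F)\<close> for its generating function,
  where \<open>\<Phi>(z, w) = \<Sum>\<^sub>Q z ^ card Q * w ^ (n - card (\<Union>Q))\<close> ranges over the partitions \<open>Q\<close> of
  sets of children of the root. Let \<open>\<rho>\<close> be the largest \<open>x \<ge> 0\<close> such that \<open>\<Phi>(x, w) \<le> w\<close> for some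
  \<open>w \<ge> 0\<close>. Then \<open>\<tau> = F(\<rho>)\<close> is finite and \<open>w \<mapsto> \<Phi>(\<rho>, w) - w\<close> has its minimum \<open>0\<close> there, so
  \<open>\<Phi>\<^sub>w(\<rho>, \<tau>) = 1\<close>; the \<open>n\<close> monomials \<open>z w\<close> of \<open>\<Phi>\<close> then force \<open>n \<rho> < 1\<close>, and \<open>D = 1 / \<rho>\<close>.

  After rescaling \<open>\<rho>\<close> to \<open>1\<close>, put \<open>U = 1 - \<Phi>\<^sub>w(z, F)\<close>. Since \<open>F' = \<Phi>\<^sub>z / U\<close>, the derivative of
  \<open>U\<^sup>2\<close> is a polynomial in \<open>z\<close> and \<open>F\<close>, which gives \<open>U\<^sup>2 \<approx> 2 \<gamma> (1 - z)\<close> at \<open>1\<close>. Hence \<open>F'\<close> differs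
  from a multiple of \<open>(1 - z)\<close> to the power \<open>-1/2\<close> by a function with derivative \<open>O(1 / |1 - z|)\<close>,
  whose coefficients are only \<open>O(ln k / k)\<close>. No analytic continuation beyond the disc is needed.\<close>

section \<open>Lower decorated sweep covers as families of blocks\<close>

text \<open>The number \<open>\<rho>\<close> is defined by solvability of an inequality and not as a
  radius of convergence, because both facts needed there then follow from continuity. The partial
  sums \<open>s\<close> of \<open>F\<close> are polynomials with \<open>s \<le> \<Phi>(x, s)\<close>
  and start at \<open>0\<close>, so they stay below a solution \<open>w\<close>; this yields
  convergence on the closed disc. A strict inequality \<open>\<Phi>(\<rho>, w) < w\<close> would
  persist for slightly larger \<open>x\<close>, so \<open>\<Phi>(\<rho>, w) - w\<close> has no
  negative value. The obstacle at \<open>1\<close> is that a good error term for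
  \<open>U\<^sup>2\<close> needs control of \<open>F'\<close>, which itself depends on
  \<open>U\<close>. Two rounds resolve this: continuity of \<open>F\<close> alone bounds
  \<open>|U|\<close> below by a multiple of \<open>sqrt |1 - z|\<close>; then \<open>F'\<close> is
  at most of the order of the inverse root, and the error in \<open>U\<^sup>2\<close> improves to
  \<open>|1 - z|\<close> to the power \<open>3/2\<close>. In \<open>O(ln k / k)\<close> the
  logarithm is the integral of \<open>1 / |1 - z|\<close> over a circle of radius about
  \<open>1 - 1/k\<close>, and the factor \<open>1/k\<close> comes from having bounded a derivative.
  The main term of order \<open>1 / sqrt k\<close> dominates, and passing from \<open>F'\<close> to
  \<open>F\<close> divides by \<open>k\<close> once more.\<close>

definition sweep :: "nat \<Rightarrow> nat list set \<Rightarrow> bool" where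
  "sweep n S \<longleftrightarrow> S \<subseteq> lists {..<n} \<and> (\<forall>p\<in>S. \<forall>q\<in>S. prefix p q \<longrightarrow> p = q) \<and>
     (\<forall>w\<in>lists {..<n}. \<exists>q\<in>S. prefix w q \<or> prefix q w)"

text \<open>In \<open>sweep\<close> one \<open>prefix\<close> suffices for incomparability, as the
  pair ranges over both orders, and the covering condition may include the words of
  \<open>S\<close>, each being a prefix of itself.\<close>

lemma maximal_antichain_tree: "maximal_antichain (tree n) tree_le S \<longleftrightarrow> sweep n S"
proof
  assume "maximal_antichain (tree n) tree_le S"
  then show "sweep n S"
    unfolding sweep_def maximal_antichain_def antichain_def comparable_def tree_def tree_le_def
    by (metis Diff_iff prefix_order.order_refl)
next
  assume "sweep n S"
  then show "maximal_antichain (tree n) tree_le S"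
    unfolding sweep_def maximal_antichain_def antichain_def comparable_def tree_def tree_le_def
    by (metis Diff_iff)
qed

lemma covers_tree:
  "covers (tree n) tree_le p q \<longleftrightarrow> p \<in> lists {..<n} \<and> (\<exists>i<n. q = p @ [i])"
proof
  assume L: "covers (tree n) tree_le p q"
  then have p: "p \<in> lists {..<n}" and q: "q \<in> lists {..<n}" and "prefix p q" "p \<noteq> q"
    and no: "\<not> (\<exists>r\<in>lists {..<n}. prefix r q \<and> q \<noteq> r \<and> prefix p r \<and> r \<noteq> p)"
    by (auto simp: covers_def tree_def tree_le_def)
  then obtain i v where qv: "q = p @ i # v"
    by (metis append_Nil2 neq_Nil_conv prefixE)
  with q have i: "i < n" "set v \<subseteq> {..<n}" by auto
  have "v = []"
  proof (rule ccontr)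
    assume "v \<noteq> []"
    then show False using no i p unfolding qv
      by (auto dest!: bspec[of _ _ "p @ [i]"])
  qed
  then show "p \<in> lists {..<n} \<and> (\<exists>i<n. q = p @ [i])" using p i qv by auto
next
  assume R: "p \<in> lists {..<n} \<and> (\<exists>i<n. q = p @ [i])"
  then show "covers (tree n) tree_le p q"
    by (auto simp: covers_def tree_def tree_le_def prefix_def append_eq_append_conv2
        append_eq_Cons_conv Cons_eq_append_conv)
qed

text \<open>The root has to be excluded: \<open>butlast []\<close> is \<open>[]\<close>, the same
  value as on its children, with which it has no common parent.\<close>

lemma siblings_tree:
  assumes "p \<in> lists {..<n}" "q \<in> lists {..<n}" "p \<noteq> []" "q \<noteq> []"
  shows "siblings (tree n) tree_le p q \<longleftrightarrow> butlast p = butlast q"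
proof
  assume "siblings (tree n) tree_le p q"
  then show "butlast p = butlast q" by (auto simp: siblings_def covers_tree)
next
  assume b: "butlast p = butlast q"
  have *: "covers (tree n) tree_le (butlast w) w" if "w \<in> lists {..<n}" "w \<noteq> []" for w
    unfolding covers_tree using that
    by (intro conjI exI[of _ "last w"]) (auto dest: in_set_butlastD)
  show "siblings (tree n) tree_le p q"
    unfolding siblings_def using *[of p] *[of q] assms b by metis
qed

lemma sweep_Nil:
  assumes "sweep n S" "[] \<in> S"
  shows "S = {[]}"
proof -
  have "[] = q" if "q \<in> S" for q
    using assms that Nil_prefix[of q] unfolding sweep_def by metis
  then show ?thesis using assms(2) by auto
qed

lemma sweep_singleton_Nil: "sweep n {[]}"
  unfolding sweep_def by auto

lemma sweep_nonempty: "sweep n S \<Longrightarrow> S \<noteq> {}"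
  unfolding sweep_def using lists.Nil by blast

text \<open>Words with different first letters are incomparable, so both conditions split over the
  subtrees of the children. Only the empty word lies in no subtree; any word of \<open>S\<close>
  below the child \<open>0\<close> is comparable to it, which takes \<open>n > 0\<close>.\<close>

lemma sweep_Cons:
  assumes "[] \<notin> S" "n > 0" "S \<subseteq> lists {..<n}"
  shows "sweep n S \<longleftrightarrow> (\<forall>i<n. sweep n (Cons i -` S))"
proof
  assume S: "sweep n S"
  show "\<forall>i<n. sweep n (Cons i -` S)"
  proof (intro allI impI)
    fix i assume i: "i < n"
    have "\<exists>q\<in>Cons i -` S. prefix w q \<or> prefix q w" if "w \<in> lists {..<n}" for w
    proof -
      have "i # w \<in> lists {..<n}" using that i by auto
      then obtain q where q: "q \<in> S" "prefix (i # w) q \<or> prefix q (i # w)"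
        using S unfolding sweep_def by blast
      obtain j v where "q = j # v" using q \<open>[] \<notin> S\<close> by (cases q) auto
      then show ?thesis using q by (intro bexI[of _ v]) auto
    qed
    moreover have "Cons i -` S \<subseteq> lists {..<n}" using assms(3) by auto
    moreover have "p = q" if "p \<in> Cons i -` S" "q \<in> Cons i -` S" "prefix p q" for p q
    proof -
      have "i # p = i # q" using that S unfolding sweep_def by (auto simp del: list.inject)
      then show ?thesis by simp
    qed
    ultimately show "sweep n (Cons i -` S)" unfolding sweep_def by blast
  qed
next
  assume R: "\<forall>i<n. sweep n (Cons i -` S)"
  have "p = q" if pq: "p \<in> S" "q \<in> S" "prefix p q" for p q
  proof -
    obtain i v where p: "p = i # v" using pq \<open>[] \<notin> S\<close> by (cases p) auto
    with pq obtain u where q: "q = i # u" "prefix v u" by (cases q) auto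
    have "i < n" using pq p assms(3) by auto
    with R have "sweep n (Cons i -` S)" by blast
    then show ?thesis using pq p q unfolding sweep_def by auto
  qed
  moreover have "\<exists>q\<in>S. prefix w q \<or> prefix q w" if "w \<in> lists {..<n}" for w
  proof (cases w)
    case Nil
    have "Cons 0 -` S \<noteq> {}" using R \<open>n > 0\<close> sweep_nonempty by blast
    then show ?thesis using Nil by auto
  next
    case (Cons i v)
    with that have "i < n" "v \<in> lists {..<n}" by auto
    with R have "sweep n (Cons i -` S)" by blast
    with \<open>v \<in> lists {..<n}\<close> obtain q where "i # q \<in> S" "prefix v q \<or> prefix q v"
      unfolding sweep_def by blast
    then show ?thesis using Cons by (intro bexI[of _ "i # q"]) auto
  qed
  ultimately show "sweep n S" using assms(3) unfolding sweep_def by blast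
qed

text \<open>A cover is encoded by the family of its colour classes; the antichain is their union. A class
  of siblings is one on which \<open>butlast\<close> is constant, as the root does not occur.\<close>

definition lower_dscs :: "nat \<Rightarrow> nat list set set set" where
  "lower_dscs n = {P. finite P \<and> {} \<notin> P \<and> disjoint P \<and> sweep n (\<Union>P) \<and> [] \<notin> \<Union>P \<and>
     (\<forall>X\<in>P. \<exists>v. butlast ` X \<subseteq> {v})}"

definition fibres :: "nat \<Rightarrow> nat list set \<times> (nat list \<Rightarrow> nat) \<Rightarrow> nat list set set" where
  "fibres k = (\<lambda>(S, c). (\<lambda>i. {p \<in> S. c p = i}) ` {..<k})"

text \<open>With \<open>fibres k\<close> as \<open>g\<close> this turns counting modulo recolouring
  into counting families of blocks.\<close>

lemma card_quotient_kernel: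
  assumes "\<And>x y. x \<in> A \<Longrightarrow> y \<in> A \<Longrightarrow> (x, y) \<in> R \<longleftrightarrow> g x = g y"
  shows "card (A // (R \<inter> A \<times> A)) = card (g ` A)"
proof -
  have cls: "(R \<inter> A \<times> A) `` {x} = {y \<in> A. g y = g x}" if "x \<in> A" for x
    using assms that by auto
  have "A // (R \<inter> A \<times> A) = (\<lambda>v. {y \<in> A. g y = v}) ` (g ` A)"
    unfolding quotient_def image_image using cls by auto
  moreover have "inj_on (\<lambda>v. {y \<in> A. g y = v}) (g ` A)"
    by (rule inj_onI) blast
  ultimately show ?thesis by (simp add: card_image)
qed

lemma lower_colourings_iff:
  "(S, c) \<in> lower_colourings n k \<longleftrightarrow> sweep n S \<and> [] \<notin> S \<and> c \<in> S \<rightarrow>\<^sub>E {..<k} \<and> c ` S = {..<k} \<and>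
     (\<forall>p\<in>S. \<forall>q\<in>S. c p = c q \<longrightarrow> butlast p = butlast q)"
proof -
  have nil: "[] \<notin> S \<longleftrightarrow> S \<noteq> {[]}" if "sweep n S" using sweep_Nil[OF that] by auto
  have sib: "siblings (tree n) tree_le p q \<longleftrightarrow> butlast p = butlast q"
    if "sweep n S" "[] \<notin> S" "p \<in> S" "q \<in> S" for p q
    using that by (intro siblings_tree) (auto simp: sweep_def)
  have "(\<forall>p\<in>S. \<forall>q\<in>S. p \<noteq> q \<and> c p = c q \<longrightarrow> siblings (tree n) tree_le p q) \<longleftrightarrow>
      (\<forall>p\<in>S. \<forall>q\<in>S. c p = c q \<longrightarrow> butlast p = butlast q)"
    if "sweep n S" "[] \<notin> S"
  proof (intro ball_cong refl)
    fix p q assume "p \<in> S" "q \<in> S"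
    then show "(p \<noteq> q \<and> c p = c q \<longrightarrow> siblings (tree n) tree_le p q) \<longleftrightarrow>
        (c p = c q \<longrightarrow> butlast p = butlast q)"
      by (cases "p = q") (simp_all add: sib[OF that])
  qed
  then show ?thesis
    unfolding lower_colourings_def colourings_def maximal_antichain_tree mem_Collect_eq prod.case
    using nil by argo
qed

text \<open>A permutation of the colours merely reindexes the fibres. Conversely, equal families
  have the same union, so \<open>S = T\<close>, and put the same pairs of words into one block, so
  \<open>d\<close> factors through \<open>c\<close>; the factor is the permutation.\<close>

lemma recolouring_iff_fibres:
  assumes "x \<in> lower_colourings n k" "y \<in> lower_colourings n k"
  shows "(x, y) \<in> recolouring {..<k} \<longleftrightarrow> fibres k x = fibres k y"
proof -
  obtain S c T d where xy: "x = (S, c)" "y = (T, d)" by fastforce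
  have c: "c ` S = {..<k}" and d: "d ` T = {..<k}"
    using assms by (simp_all add: xy lower_colourings_iff)
  have US: "\<Union>(fibres k (S, c)) = S" "\<Union>(fibres k (T, d)) = T"
    using c d unfolding fibres_def by auto
  show ?thesis
  proof
    assume "(x, y) \<in> recolouring {..<k}"
    then obtain \<pi> where ST: "S = T" and \<pi>: "bij_betw \<pi> {..<k} {..<k}"
      and dc: "\<And>p. p \<in> S \<Longrightarrow> d p = \<pi> (c p)"
      unfolding recolouring_def xy by auto
    have "fibres k y = (\<lambda>i. {p \<in> T. d p = i}) ` (\<pi> ` {..<k})"
      using \<pi> by (simp add: fibres_def xy bij_betw_def)
    also have "\<dots> = (\<lambda>i. {p \<in> S. c p = i}) ` {..<k}"
      unfolding image_image
    proof (rule image_cong[OF refl])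
      fix i assume i: "i \<in> {..<k}"
      have "\<pi> (c p) = \<pi> i \<longleftrightarrow> c p = i" if "p \<in> S" for p
      proof -
        have "c p \<in> {..<k}" using that c by blast
        then show ?thesis using inj_on_eq_iff[OF bij_betw_imp_inj_on[OF \<pi>] _ i] by blast
      qed
      then show "{p \<in> T. d p = \<pi> i} = {p \<in> S. c p = i}"
        using ST dc by auto
    qed
    finally show "fibres k x = fibres k y" by (simp add: fibres_def xy)
  next
    assume eq: "fibres k x = fibres k y"
    then have ST: "S = T" using US xy by metis
    have iff: "c p = c q \<longleftrightarrow> d p = d q" if "p \<in> S" "q \<in> S" for p q
    proof -
      have "c p = c q \<longleftrightarrow> (\<exists>X\<in>fibres k x. p \<in> X \<and> q \<in> X)"
        using that c unfolding fibres_def xy by auto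
      moreover have "d p = d q \<longleftrightarrow> (\<exists>X\<in>fibres k y. p \<in> X \<and> q \<in> X)"
        using that d ST unfolding fibres_def xy by auto
      ultimately show ?thesis using eq by simp
    qed
    define \<pi> where "\<pi> = d \<circ> inv_into S c"
    have \<pi>: "\<pi> (c p) = d p" if "p \<in> S" for p
      unfolding \<pi>_def comp_def using that iff[of "inv_into S c (c p)" p]
      by (simp add: f_inv_into_f inv_into_into)
    have "\<pi> ` {..<k} = {..<k}"
      using \<pi> d unfolding c[symmetric] image_image ST by (auto simp: image_iff)
    moreover have "inj_on \<pi> {..<k}"
      using \<pi> iff unfolding c[symmetric] by (auto intro!: inj_onI)
    ultimately show "(x, y) \<in> recolouring {..<k}"
      unfolding recolouring_def xy using ST \<pi> by (auto simp: bij_betw_def intro!: exI[of _ \<pi>])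
  qed
qed

lemma fibres_image:
  "fibres k ` lower_colourings n k = {P \<in> lower_dscs n. card P = k}"
proof (intro equalityI subsetI)
  fix P assume "P \<in> fibres k ` lower_colourings n k"
  then obtain S c where P: "P = (\<lambda>i. {p \<in> S. c p = i}) ` {..<k}"
    and "(S, c) \<in> lower_colourings n k"
    by (auto simp: fibres_def)
  then have S: "sweep n S" "[] \<notin> S" and c: "c ` S = {..<k}"
    and b: "\<And>p q. p \<in> S \<Longrightarrow> q \<in> S \<Longrightarrow> c p = c q \<Longrightarrow> butlast p = butlast q"
    unfolding lower_colourings_iff by blast+
  have ne: "{p \<in> S. c p = i} \<noteq> {}" if "i < k" for i
  proof -
    have "i \<in> c ` S" using c that by simp
    then show ?thesis by blast
  qed
  have "\<Union>P = S" using c unfolding P by auto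
  moreover have "inj_on (\<lambda>i. {p \<in> S. c p = i}) {..<k}"
    by (rule inj_onI) (use ne in blast)
  then have "card P = k" unfolding P by (simp add: card_image)
  moreover have "disjoint P" unfolding P disjoint_def by auto
  moreover have "{} \<notin> P" "finite P" using ne unfolding P by blast+
  moreover have "\<exists>v. butlast ` X \<subseteq> {v}" if "X \<in> P" for X
  proof -
    obtain i where X: "i < k" "X = {p \<in> S. c p = i}" using \<open>X \<in> P\<close> unfolding P by blast
    then obtain r where "r \<in> S" "c r = i" using ne by blast
    then have "butlast p = butlast r" if "p \<in> X" for p
      using that unfolding X by (intro b) simp_all
    then show ?thesis by blast
  qed
  ultimately show "P \<in> {P \<in> lower_dscs n. card P = k}"
    using S by (simp add: lower_dscs_def del: Union_iff)
next
  fix P assume "P \<in> {P \<in> lower_dscs n. card P = k}"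
  then have fin: "finite P" and "{} \<notin> P" and disj: "disjoint P" and S: "sweep n (\<Union>P)" "[] \<notin> \<Union>P"
    and b: "\<forall>X\<in>P. \<exists>v. butlast ` X \<subseteq> {v}" and k: "card P = k"
    by (simp_all add: lower_dscs_def del: Union_iff)
  obtain h where h: "bij_betw h P {..<k}"
    using fin k finite_same_card_bij[of P "{..<k}"] by auto
  \<comment> \<open>Any numbering \<open>h\<close> of the blocks will do. Disjointness makes
    \<open>THE\<close> pick the one block around \<open>p\<close>, and the restriction makes
    \<open>c\<close> extensional.\<close>
  define c where "c = (\<lambda>p\<in>\<Union>P. h (THE X. X \<in> P \<and> p \<in> X))"
  have c: "c p = h X" if "X \<in> P" "p \<in> X" for p X
  proof -
    have "(THE X. X \<in> P \<and> p \<in> X) = X"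
      using that disj by (intro the_equality) (auto simp: disjoint_def)
    then show ?thesis using that by (auto simp: c_def)
  qed
  have fib: "{p \<in> \<Union>P. c p = h X} = X" if "X \<in> P" for X
    using that c h by (auto simp: bij_betw_def inj_on_eq_iff)
  have hP: "h ` P = {..<k}" using h by (simp add: bij_betw_def)
  have "fibres k (\<Union>P, c) = P"
    unfolding fibres_def prod.case hP[symmetric] image_image using fib by simp
  moreover have "(\<Union>P, c) \<in> lower_colourings n k"
    unfolding lower_colourings_iff
  proof (intro conjI ballI impI)
    show "c \<in> \<Union>P \<rightarrow>\<^sub>E {..<k}"
    proof (rule PiE_I)
      fix p assume "p \<in> \<Union>P"
      then show "c p \<in> {..<k}" using c hP by blast
    qed (auto simp: c_def)
    have "c ` \<Union>P = h ` P"
      using c \<open>{} \<notin> P\<close> by (auto simp: image_iff) (metis UN_I Union_iff all_not_in_conv)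
    then show "c ` \<Union>P = {..<k}" using hP by simp
  next
    fix p q assume "p \<in> \<Union>P" "q \<in> \<Union>P" and e: "c p = c q"
    then obtain X Y where XY: "X \<in> P" "p \<in> X" "Y \<in> P" "q \<in> Y" by blast
    then have "X = Y" using e c h by (auto simp: bij_betw_def inj_on_eq_iff)
    then show "butlast p = butlast q" using XY b by blast
  qed (use S in auto)
  ultimately show "P \<in> fibres k ` lower_colourings n k" by (metis image_eqI)
qed

lemma num_lower_dsc_eq: "num_lower_dsc n k = card {P \<in> lower_dscs n. card P = k}"
  unfolding num_lower_dsc_def fibres_image[symmetric]
  by (rule card_quotient_kernel) (rule recolouring_iff_fibres)

section \<open>Decomposition at the root\<close>

text \<open>\<open>Q\<close> consists of the colour classes made of children of the root, and \<open>g i\<close> is the cover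
  below a child \<open>i\<close> that is not coloured itself.\<close>

definition level_one :: "nat \<Rightarrow> nat set set set" where
  "level_one n = {Q. Q \<subseteq> Pow {..<n} \<and> {} \<notin> Q \<and> disjoint Q}"

definition graft :: "nat \<Rightarrow> nat set set \<Rightarrow> (nat \<Rightarrow> nat list set set) \<Rightarrow> nat list set set" where
  "graft n Q g = image (\<lambda>i. [i]) ` Q \<union> (\<Union>i\<in>{..<n} - \<Union>Q. image (Cons i) ` g i)"

text \<open>The inverse of grafting: traces of the blocks on the children of the root
  (\<open>f\<close> the singleton map) or on one subtree (\<open>f = Cons i\<close>). Blocks lying
  elsewhere have empty trace, hence the removal of \<open>{}\<close>.\<close>

definition pull :: "('a \<Rightarrow> 'b) \<Rightarrow> 'b set set \<Rightarrow> 'a set set" where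
  "pull f P = (\<lambda>X. f -` X) ` P - {{}}"

definition graft_args :: "nat \<Rightarrow> (nat set set \<times> (nat \<Rightarrow> nat list set set)) set" where
  "graft_args n = (SIGMA Q:level_one n. ({..<n} - \<Union>Q) \<rightarrow>\<^sub>E lower_dscs n)"

lemma finite_level_one: "finite (level_one n)"
  by (rule finite_subset[of _ "Pow (Pow {..<n})"]) (auto simp: level_one_def)

lemma level_one_memD:
  assumes "Q \<in> level_one n"
  shows "finite Q" "{} \<notin> Q" "disjoint Q" "\<Union>Q \<subseteq> {..<n}"
proof -
  have "Q \<subseteq> Pow {..<n}" using assms by (simp add: level_one_def)
  then show "finite Q" by (rule finite_subset) simp
qed (use assms in \<open>auto simp: level_one_def\<close>)

lemma lower_dscs_memD:
  assumes "P \<in> lower_dscs n"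
  shows "finite P" "{} \<notin> P" "disjoint P" "sweep n (\<Union>P)" "[] \<notin> \<Union>P"
    "\<And>X. X \<in> P \<Longrightarrow> \<exists>v. butlast ` X \<subseteq> {v}" "\<Union>P \<subseteq> lists {..<n}"
  using assms by (auto simp: lower_dscs_def sweep_def)

lemma vimage_singleton_list: "(\<lambda>i. [i]) -` ((\<lambda>i. [i]) ` X) = X"
  by auto

lemma vimage_Cons_image: "Cons i -` (Cons j ` X) = (if i = j then X else {})"
  by auto

lemma vimage_Cons_singleton: "Cons i -` ((\<lambda>i. [i]) ` X) = (if i \<in> X then {[]} else {})"
  by auto

lemma vimage_singleton_Cons: "[] \<notin> X \<Longrightarrow> (\<lambda>i. [i]) -` (Cons j ` X) = {}"
  by auto

lemma pull_Un: "(\<And>X. X \<in> B \<Longrightarrow> f -` X = {}) \<Longrightarrow> pull f (A \<union> B) = pull f A"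
  unfolding pull_def by auto

lemma Union_image_Cons:
  "\<Union>(image (\<lambda>i. [i]) ` Q \<union> (\<Union>i\<in>I. image (Cons i) ` g i)) =
    (\<lambda>i. [i]) ` \<Union>Q \<union> (\<Union>j\<in>I. Cons j ` \<Union>(g j))"
  by fastforce

lemma image_Cons_cases:
  assumes "X \<in> image (\<lambda>i. [i]) ` Q \<union> (\<Union>i\<in>I. image (Cons i) ` g i)"
  shows "(\<exists>q\<in>Q. X = (\<lambda>i. [i]) ` q) \<or> (\<exists>i\<in>I. \<exists>Z\<in>g i. X = Cons i ` Z)"
  using assms by fast

text \<open>As \<open>[]\<close> occurs in no \<open>g i\<close>, a word from below a child is never
  a one-letter word; words below different children differ in their first letter.\<close>

lemma disjoint_image_Cons:
  assumes Q: "disjoint Q" and g: "\<And>i. i \<in> I \<Longrightarrow> disjoint (g i)" "\<And>i. i \<in> I \<Longrightarrow> [] \<notin> \<Union>(g i)"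
  shows "disjoint (image (\<lambda>i. [i]) ` Q \<union> (\<Union>i\<in>I. image (Cons i) ` g i))"
proof -
  let ?s = "\<lambda>i::'a. [i]"
  have a: "?s ` q \<inter> ?s ` q' = {}" if "q \<in> Q" "q' \<in> Q" "?s ` q \<noteq> ?s ` q'" for q q'
  proof -
    have "q \<inter> q' = {}" using that Q unfolding disjoint_def by metis
    then show ?thesis by auto
  qed
  have b: "?s ` q \<inter> Cons i ` Y = {}" "Cons i ` Y \<inter> ?s ` q = {}" if "i \<in> I" "Y \<in> g i" for q i Y
    using that g(2) by auto
  have c: "Cons i ` Y \<inter> Cons j ` Z = {}"
    if "i \<in> I" "j \<in> I" "Y \<in> g i" "Z \<in> g j" "Cons i ` Y \<noteq> Cons j ` Z" for i j Y Z
  proof (cases "i = j")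
    case True
    then have "Y \<inter> Z = {}" using that g(1)[of j] unfolding disjoint_def by metis
    then show ?thesis by auto
  qed auto
  show ?thesis
    unfolding disjoint_def
  proof (intro ballI impI)
    fix X Y assume "X \<in> image ?s ` Q \<union> (\<Union>i\<in>I. image (Cons i) ` g i)"
      "Y \<in> image ?s ` Q \<union> (\<Union>i\<in>I. image (Cons i) ` g i)" and XY: "X \<noteq> Y"
    then have "(\<exists>q\<in>Q. X = ?s ` q) \<or> (\<exists>i\<in>I. \<exists>Z\<in>g i. X = Cons i ` Z)"
      "(\<exists>q\<in>Q. Y = ?s ` q) \<or> (\<exists>i\<in>I. \<exists>Z\<in>g i. Y = Cons i ` Z)"
      by (blast intro!: image_Cons_cases)+
    then show "X \<inter> Y = {}"
    proof (elim disjE bexE)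
      fix q q' assume "q \<in> Q" "q' \<in> Q" "X = ?s ` q" "Y = ?s ` q'"
      then show ?thesis using a[of q q'] XY by simp
    next
      fix q i Z assume "i \<in> I" "Z \<in> g i" "X = ?s ` q" "Y = Cons i ` Z"
      then show ?thesis using b(1)[of i Z q] by simp
    next
      fix q i Z assume "i \<in> I" "Z \<in> g i" "Y = ?s ` q" "X = Cons i ` Z"
      then show ?thesis using b(2)[of i Z q] by simp
    next
      fix i j Z W assume "i \<in> I" "Z \<in> g i" "j \<in> I" "W \<in> g j" "X = Cons i ` Z" "Y = Cons j ` W"
      then show ?thesis using c[of i j Z W] XY by simp
    qed
  qed
qed

lemma graft_cases:
  assumes "X \<in> graft n Q g"
  shows "(\<exists>q\<in>Q. X = (\<lambda>i. [i]) ` q) \<or> (\<exists>i\<in>{..<n} - \<Union>Q. \<exists>Y\<in>g i. X = Cons i ` Y)"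
  using assms unfolding graft_def by (rule image_Cons_cases)

context
  fixes n Q g
  assumes n: "n > 0" and Q: "Q \<in> level_one n" and g: "g \<in> ({..<n} - \<Union>Q) \<rightarrow>\<^sub>E lower_dscs n"
begin

lemma graft_arg_mem: "i < n \<Longrightarrow> i \<notin> \<Union>Q \<Longrightarrow> g i \<in> lower_dscs n"
  using g by auto

text \<open>Together with \<open>pull_Cons_graft\<close> this recovers both arguments of a graft,
  whence the injectivity in \<open>bij_betw_graft\<close>.\<close>

lemma pull_singleton_graft: "pull (\<lambda>i. [i]) (graft n Q g) = Q"
proof -
  have *: "(\<lambda>i. [i]) -` X = {}" if "i \<in> {..<n} - \<Union>Q" "X \<in> image (Cons i) ` g i" for i X
  proof -
    have "g i \<in> lower_dscs n" using graft_arg_mem that by auto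
    then show ?thesis using that lower_dscs_memD(5) vimage_singleton_Cons by fastforce
  qed
  have "pull (\<lambda>i. [i]) (graft n Q g) = pull (\<lambda>i. [i]) (image (\<lambda>i. [i]) ` Q)"
    unfolding graft_def by (rule pull_Un) (elim UN_E, rule *)
  also have "\<dots> = (\<lambda>X. (\<lambda>i. [i]) -` ((\<lambda>i. [i]) ` X)) ` Q - {{}}"
    unfolding pull_def image_image ..
  also have "\<dots> = Q" using level_one_memD(2)[OF Q] by (simp add: vimage_singleton_list)
  finally show ?thesis .
qed

lemma pull_Cons_graft:
  assumes i: "i < n" "i \<notin> \<Union>Q"
  shows "pull (Cons i) (graft n Q g) = g i"
proof -
  have 1: "Cons i -` X = {}" if "X \<in> image (\<lambda>i. [i]) ` Q" for X
    using that i by auto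
  have 2: "Cons i -` X = {}" if "j \<noteq> i" "X \<in> image (Cons j) ` g j" for X j
    using that by auto
  let ?I = "{..<n} - \<Union>Q"
  have I: "?I = insert i (?I - {i})" using i by auto
  have "graft n Q g = image (Cons i) ` g i \<union>
      (image (\<lambda>i. [i]) ` Q \<union> (\<Union>j\<in>?I - {i}. image (Cons j) ` g j))"
    unfolding graft_def by (subst I) (simp only: UN_insert Un_ac)
  also have "pull (Cons i) \<dots> = pull (Cons i) (image (Cons i) ` g i)"
    by (rule pull_Un) (elim UnE UN_E, rule 1, assumption, rule 2[rotated], assumption, blast)
  also have "\<dots> = (\<lambda>X. Cons i -` (Cons i ` X)) ` g i - {{}}"
    unfolding pull_def image_image ..
  also have "\<dots> = g i" using lower_dscs_memD(2)[OF graft_arg_mem[OF i]] by (simp add: vimage_Cons_image)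
  finally show ?thesis .
qed

lemma vimage_Cons_Union_graft:
  assumes "i < n"
  shows "Cons i -` \<Union>(graft n Q g) = (if i \<in> \<Union>Q then {[]} else \<Union>(g i))"
proof -
  have "\<Union>(graft n Q g) = (\<lambda>i. [i]) ` \<Union>Q \<union> (\<Union>j\<in>{..<n} - \<Union>Q. Cons j ` \<Union>(g j))"
    unfolding graft_def by (rule Union_image_Cons)
  then have "Cons i -` \<Union>(graft n Q g) = (if i \<in> \<Union>Q then {[]} else {}) \<union>
      (\<Union>j\<in>{..<n} - \<Union>Q. if i = j then \<Union>(g j) else {})"
    by (simp only: vimage_Un vimage_UN vimage_Cons_singleton vimage_Cons_image)
  also have "(\<Union>j\<in>{..<n} - \<Union>Q. if i = j then \<Union>(g j) else {}) = (if i \<in> \<Union>Q then {} else \<Union>(g i))"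
    using assms by (simp del: Union_iff)
  finally show ?thesis by simp
qed

lemma Nil_notin_graft: "[] \<notin> \<Union>(graft n Q g)"
  unfolding graft_def by auto

lemma graft_subset_lists: "\<Union>(graft n Q g) \<subseteq> lists {..<n}"
proof -
  have "\<Union>(g i) \<subseteq> lists {..<n}" if "i \<in> {..<n} - \<Union>Q" for i
    using that lower_dscs_memD(7) graft_arg_mem by auto
  then show ?thesis
    using level_one_memD(4)[OF Q] unfolding graft_def by fastforce
qed

lemma disjoint_graft: "disjoint (graft n Q g)"
  unfolding graft_def
  using lower_dscs_memD(3,5)[OF graft_arg_mem] level_one_memD(3)[OF Q]
  by (intro disjoint_image_Cons) auto

lemma graft_mem: "graft n Q g \<in> lower_dscs n"
proof -
  have gi: "g i \<in> lower_dscs n" if "i \<in> {..<n} - \<Union>Q" for i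
    using graft_arg_mem that by auto
  have "finite (graft n Q g)"
    unfolding graft_def using level_one_memD(1)[OF Q] lower_dscs_memD(1)[OF gi] by blast
  moreover have "{} \<notin> graft n Q g"
    unfolding graft_def using level_one_memD(2)[OF Q] lower_dscs_memD(2)[OF gi] by blast
  moreover have "sweep n (\<Union>(graft n Q g))"
    unfolding sweep_Cons[OF Nil_notin_graft n graft_subset_lists]
    using sweep_singleton_Nil lower_dscs_memD(4)[OF gi] by (simp add: vimage_Cons_Union_graft)
  moreover have "\<exists>v. butlast ` X \<subseteq> {v}" if X: "X \<in> graft n Q g" for X
  proof -
    consider "X \<in> image (\<lambda>i. [i]) ` Q"
      | i Y where "i \<in> {..<n} - \<Union>Q" "Y \<in> g i" "X = Cons i ` Y"
      using graft_cases[OF X] by auto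
    then show ?thesis
    proof cases
      case 1
      then have "butlast ` X \<subseteq> {[]}" by auto
      then show ?thesis ..
    next
      case 2
      obtain v where "butlast ` Y \<subseteq> {v}" using lower_dscs_memD(6)[OF gi[OF 2(1)] 2(2)] by blast
      moreover have "[] \<notin> Y" using lower_dscs_memD(5)[OF gi[OF 2(1)]] 2(2) by blast
      ultimately have "butlast ` X \<subseteq> {i # v}" unfolding 2 by auto
      then show ?thesis ..
    qed
  qed
  ultimately show ?thesis
    using disjoint_graft Nil_notin_graft by (simp add: lower_dscs_def del: Union_iff)
qed

lemma card_graft: "card (graft n Q g) = card Q + (\<Sum>i\<in>{..<n} - \<Union>Q. card (g i))"
proof -
  let ?I = "{..<n} - \<Union>Q"
  have gi: "g i \<in> lower_dscs n" if "i \<in> ?I" for i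
    using graft_arg_mem that by auto
  \<comment> \<open>All words of a block below \<open>i\<close> start with \<open>i\<close>, so
    \<open>hd\<close> tells the blocks of different subtrees apart and makes the unions below
    disjoint.\<close>
  have hd: "hd ` Y = {i}" if iY: "i \<in> ?I" "Y \<in> image (Cons i) ` g i" for i Y
  proof -
    obtain Z where Z: "Z \<in> g i" "Y = Cons i ` Z" using iY(2) by blast
    then have "Z \<noteq> {}" using lower_dscs_memD(2)[OF gi[OF iY(1)]] by blast
    then show ?thesis unfolding Z image_image by auto
  qed
  have "card (\<Union>i\<in>?I. image (Cons i) ` g i) = (\<Sum>i\<in>?I. card (image (Cons i) ` g i))"
  proof (rule card_UN_disjoint)
    show "\<forall>i\<in>?I. \<forall>j\<in>?I. i \<noteq> j \<longrightarrow> (image (Cons i) ` g i) \<inter> (image (Cons j) ` g j) = {}"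
    proof (intro ballI impI equals0I)
      fix i j Y assume "i \<in> ?I" "j \<in> ?I" "i \<noteq> j" "Y \<in> (image (Cons i) ` g i) \<inter> (image (Cons j) ` g j)"
      then have "{i} = {j}" using hd[of i Y] hd[of j Y] by (metis IntE)
      then show False using \<open>i \<noteq> j\<close> by simp
    qed
  qed (use lower_dscs_memD(1)[OF gi] in auto)
  also have "\<dots> = (\<Sum>i\<in>?I. card (g i))"
    by (intro sum.cong refl card_image inj_on_image inj_onI) simp
  finally have 2: "card (\<Union>i\<in>?I. image (Cons i) ` g i) = (\<Sum>i\<in>?I. card (g i))" .
  have 1: "card (image (\<lambda>i. [i]) ` Q) = card Q"
    by (intro card_image inj_on_image inj_onI) simp
  have "card (graft n Q g) = card (image (\<lambda>i. [i]) ` Q) + card (\<Union>i\<in>?I. image (Cons i) ` g i)"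
    unfolding graft_def
  proof (rule card_Un_disjoint)
    show "image (\<lambda>i. [i]) ` Q \<inter> (\<Union>i\<in>?I. image (Cons i) ` g i) = {}"
    proof (rule equals0I, elim IntE UN_E)
      fix Y i assume Y: "Y \<in> image (\<lambda>i. [i]) ` Q" and i: "i \<in> ?I" "Y \<in> image (Cons i) ` g i"
      \<comment> \<open>A block of one-letter words is the image of a member of \<open>Q\<close>,
        which \<open>hd\<close> recovers; here it would be \<open>{i}\<close>, although
        \<open>i\<close> is uncoloured.\<close>
      then have "hd ` Y \<in> Q" by (auto simp: image_image)
      then show False using hd[OF i] i(1) by auto
    qed
  qed (use level_one_memD(1)[OF Q] lower_dscs_memD(1)[OF gi] in auto)
  then show ?thesis using 1 2 by simp
qed

end

text \<open>The words of a block share one parent \<open>v\<close>. If \<open>v\<close> is the root,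
  they are one-letter words; otherwise they all lie strictly below the child named by the first
  letter of \<open>v\<close>.\<close>

lemma lower_dscs_block:
  assumes P: "P \<in> lower_dscs n" and X: "X \<in> P"
  shows "X = (\<lambda>i. [i]) ` ((\<lambda>i. [i]) -` X) \<or> (\<exists>i<n. [] \<notin> Cons i -` X \<and> X = Cons i ` (Cons i -` X))"
proof -
  note D = lower_dscs_memD[OF P]
  obtain v where v: "butlast ` X \<subseteq> {v}" using D(6)[OF X] by blast
  have w: "w \<noteq> []" "w \<in> lists {..<n}" "butlast w = v" if "w \<in> X" for w
    using v that D(5,7) X by auto
  show ?thesis
  proof (cases v)
    case Nil
    have "w \<in> range (\<lambda>i. [i])" if "w \<in> X" for w
      using w[OF that] Nil by (cases w) (auto split: if_splits)
    then show ?thesis by (auto simp: image_vimage_eq)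
  next
    case (Cons i u)
    have *: "\<exists>z. w = i # z \<and> z \<noteq> []" if "w \<in> X" for w
      using w[OF that] Cons by (cases w) (auto split: if_splits)
    have "X \<noteq> {}" using D(2) X by blast
    then have "i < n" using * w(2) by fastforce
    moreover have "[] \<notin> Cons i -` X" using * by auto
    moreover have "X \<subseteq> range (Cons i)" using * by auto
    ultimately show ?thesis by (auto simp: image_vimage_eq)
  qed
qed

lemma lower_dscs_is_graft:
  assumes n: "n > 0" and P: "P \<in> lower_dscs n"
  shows "\<exists>(Q, g)\<in>graft_args n. P = graft n Q g"
proof -
  note D = lower_dscs_memD[OF P]
  define Q where "Q = pull (\<lambda>i. [i]) P"
  define g where "g = (\<lambda>i\<in>{..<n} - \<Union>Q. pull (Cons i) P)"
  have UQ: "i \<in> \<Union>Q \<longleftrightarrow> [i] \<in> \<Union>P" for i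
    unfolding Q_def pull_def by auto
  have Q: "Q \<in> level_one n"
  proof -
    have "i < n" if "X \<in> P" "[i] \<in> X" for X i using that D(7) by auto
    then have "Q \<subseteq> Pow {..<n}" unfolding Q_def pull_def by auto
    moreover have "disjoint Q" using D(3) unfolding Q_def pull_def disjoint_def by blast
    ultimately show ?thesis unfolding level_one_def Q_def pull_def by blast
  qed
  have gi: "pull (Cons i) P \<in> lower_dscs n" if i: "i < n" "i \<notin> \<Union>Q" for i
  proof -
    have U: "\<Union>(pull (Cons i) P) = Cons i -` \<Union>P" unfolding pull_def by auto
    have N: "[] \<notin> Cons i -` \<Union>P" using i UQ by auto
    have "sweep n (\<Union>(pull (Cons i) P))"
      unfolding U using sweep_Cons[OF D(5) n D(7)] D(4) i by blast
    moreover have "[] \<notin> \<Union>(pull (Cons i) P)" using N U by simp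
    moreover have "disjoint (pull (Cons i) P)" using D(3) unfolding pull_def disjoint_def by blast
    moreover have "\<exists>v. butlast ` Y \<subseteq> {v}" if "Y \<in> pull (Cons i) P" for Y
    proof -
      obtain X where X: "X \<in> P" "Y = Cons i -` X" using \<open>Y \<in> _\<close> unfolding pull_def by blast
      obtain v where v: "butlast ` X \<subseteq> {v}" using D(6)[OF X(1)] by blast
      have "butlast w = tl v" if "w \<in> Y" for w
      proof -
        have "w \<noteq> []" using that N X by auto
        moreover have "butlast (i # w) = v" using that X v by auto
        ultimately show ?thesis by auto
      qed
      then show ?thesis by blast
    qed
    moreover have "{} \<notin> pull (Cons i) P" "finite (pull (Cons i) P)"
      using D(1) unfolding pull_def by auto
    ultimately show ?thesis unfolding lower_dscs_def by blast
  qed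
  have "P = graft n Q g"
  proof (intro equalityI subsetI)
    fix X assume X: "X \<in> P"
    have ne: "X \<noteq> {}" using D(2) X by blast
    from lower_dscs_block[OF P X] show "X \<in> graft n Q g"
    proof (elim disjE exE conjE)
      assume e: "X = (\<lambda>i. [i]) ` ((\<lambda>i. [i]) -` X)"
      then have "(\<lambda>i. [i]) -` X \<in> Q" using X ne unfolding Q_def pull_def by blast
      then show ?thesis using e unfolding graft_def by blast
    next
      fix i assume i: "i < n" "[] \<notin> Cons i -` X" and e: "X = Cons i ` (Cons i -` X)"
      \<comment> \<open>If the child \<open>i\<close> were coloured, the antichain would contain
        \<open>[i]\<close> and its proper extension \<open>i # w\<close>; here \<open>w\<close> is
        nonempty because \<open>[i]\<close> is not in \<open>X\<close>.\<close>
      have "i \<notin> \<Union>Q"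
      proof
        assume "i \<in> \<Union>Q"
        then have "[i] \<in> \<Union>P" using UQ by blast
        moreover obtain w where w: "i # w \<in> X" using ne e by blast
        ultimately have "[i] = i # w"
          using D(4) X unfolding sweep_def by (metis UnionI prefix_Cons prefix_bot.bot_least)
        then show False using w i by simp
      qed
      moreover have "Cons i -` X \<in> pull (Cons i) P" using X ne e unfolding pull_def by blast
      ultimately have "i \<in> {..<n} - \<Union>Q" "Cons i -` X \<in> g i" using i by (auto simp: g_def)
      then show ?thesis unfolding graft_def
        by (intro UnI2 UN_I[of i] image_eqI[where f = "image (Cons i)", OF e])
    qed
  next
    fix X assume "X \<in> graft n Q g"
    then consider q where "q \<in> Q" "X = (\<lambda>i. [i]) ` q"
      | i Y where "i < n" "i \<notin> \<Union>Q" "Y \<in> pull (Cons i) P" "X = Cons i ` Y"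
      using graft_cases[of X n Q g] by (auto simp: g_def)
    then show "X \<in> P"
    proof cases
      case 1
      then obtain Z where Z: "Z \<in> P" "q = (\<lambda>i. [i]) -` Z" "q \<noteq> {}"
        unfolding Q_def pull_def by blast
      then obtain j where j: "[j] \<in> Z" by blast
      from lower_dscs_block[OF P Z(1)] have "Z = (\<lambda>i. [i]) ` q"
      proof (elim disjE exE conjE)
        fix i assume "[] \<notin> Cons i -` Z" "Z = Cons i ` (Cons i -` Z)"
        then have "[j] \<in> Cons i ` (Cons i -` Z)" "[i] \<notin> Z" using j by (metis, simp)
        then show ?thesis by auto
      qed (use Z(2) in metis)
      then show ?thesis using 1 Z by simp
    next
      case 2
      then obtain Z where Z: "Z \<in> P" "Y = Cons i -` Z" "Y \<noteq> {}"
        unfolding pull_def by blast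
      have "[] \<notin> Y" using 2 Z UQ by auto
      with Z obtain w where w: "i # w \<in> Z" "w \<noteq> []" by fastforce
      from lower_dscs_block[OF P Z(1)] have "Z = Cons i ` Y"
      proof (elim disjE exE conjE)
        assume "Z = (\<lambda>i. [i]) ` ((\<lambda>i. [i]) -` Z)"
        then have "i # w \<in> (\<lambda>i. [i]) ` ((\<lambda>i. [i]) -` Z)" using w(1) by metis
        then show ?thesis using w(2) by auto
      next
        fix j assume e: "Z = Cons j ` (Cons j -` Z)"
        then have "i # w \<in> Cons j ` (Cons j -` Z)" using w(1) by metis
        then have "j = i" by auto
        then show ?thesis using Z(2) e by metis
      qed
      then show ?thesis using 2 Z by simp
    qed
  qed
  moreover have "(Q, g) \<in> graft_args n"
    unfolding graft_args_def using Q gi by (auto simp: g_def)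
  ultimately show ?thesis by blast
qed

lemma bij_betw_graft:
  assumes "n > 0"
  shows "bij_betw (\<lambda>(Q, g). graft n Q g) (graft_args n) (lower_dscs n)"
proof (rule bij_betw_imageI)
  show "inj_on (\<lambda>(Q, g). graft n Q g) (graft_args n)"
  proof (rule inj_onI, clarsimp simp: graft_args_def)
    fix Q g Q' g'
    assume Q: "Q \<in> level_one n" and g: "g \<in> ({..<n} - \<Union>Q) \<rightarrow>\<^sub>E lower_dscs n"
      and Q': "Q' \<in> level_one n" and g': "g' \<in> ({..<n} - \<Union>Q') \<rightarrow>\<^sub>E lower_dscs n"
      and eq: "graft n Q g = graft n Q' g'"
    have QQ: "Q = Q'"
      using pull_singleton_graft[OF assms Q g] pull_singleton_graft[OF assms Q' g'] eq by simp
    moreover have "g = g'"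
    proof (rule PiE_ext[OF g])
      show "g' \<in> ({..<n} - \<Union>Q) \<rightarrow>\<^sub>E lower_dscs n" using g' QQ by simp
      fix i assume i: "i \<in> {..<n} - \<Union>Q"
      then show "g i = g' i"
        using pull_Cons_graft[OF assms Q g, of i] pull_Cons_graft[OF assms Q' g', of i] eq QQ by simp
    qed
    ultimately show "Q = Q' \<and> g = g'" by simp
  qed
  show "(\<lambda>(Q, g). graft n Q g) ` graft_args n = lower_dscs n"
  proof (intro equalityI subsetI)
    fix P assume "P \<in> (\<lambda>(Q, g). graft n Q g) ` graft_args n"
    then show "P \<in> lower_dscs n" using graft_mem[OF assms] by (auto simp: graft_args_def)
  next
    fix P assume "P \<in> lower_dscs n"
    then show "P \<in> (\<lambda>(Q, g). graft n Q g) ` graft_args n"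
      using lower_dscs_is_graft[OF assms] by fastforce
  qed
qed

lemma card_lower_dsc_pos:
  assumes "P \<in> lower_dscs n"
  shows "card P > 0"
  using lower_dscs_memD(1,4)[OF assms] sweep_nonempty by (auto simp: card_gt_0_iff)

text \<open>Every component \<open>g i\<close> of a graft has fewer blocks than the whole. If
  \<open>Q\<close> is nonempty, its blocks make the difference; if \<open>Q\<close> is empty, a
  second uncoloured child \<open>j\<close> does, and this is where \<open>n \<ge> 2\<close>
  enters.\<close>

lemma finite_lower_dscs:
  assumes "n \<ge> 2"
  shows "finite {P \<in> lower_dscs n. card P = k}"
proof (induction k rule: less_induct)
  case (less k)
  define M where "M = (\<Union>m<k. {P \<in> lower_dscs n. card P = m})"
  have "finite M" unfolding M_def using less by blast
  have "{P \<in> lower_dscs n. card P = k} \<subseteq>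
      (\<lambda>(Q, g). graft n Q g) ` (SIGMA Q:level_one n. ({..<n} - \<Union>Q) \<rightarrow>\<^sub>E M)"
  proof
    fix P assume "P \<in> {P \<in> lower_dscs n. card P = k}"
    then have P: "P \<in> lower_dscs n" "card P = k" by auto
    then obtain Q g where Q: "Q \<in> level_one n" and g: "g \<in> ({..<n} - \<Union>Q) \<rightarrow>\<^sub>E lower_dscs n"
      and Pg: "P = graft n Q g"
      using lower_dscs_is_graft[of n P] assms by (auto simp: graft_args_def)
    let ?I = "{..<n} - \<Union>Q"
    have k: "k = card Q + (\<Sum>i\<in>?I. card (g i))"
      using card_graft[OF _ Q g] assms Pg P by simp
    have "card (g i) < k" if i: "i \<in> ?I" for i
    proof (cases "Q = {}")
      case True
      define j where "j = (if i = 0 then 1 else 0 :: nat)"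
      have j: "j \<in> ?I" "j \<noteq> i" using True assms by (auto simp: j_def)
      have "card (g i) + card (g j) = (\<Sum>x\<in>{i, j}. card (g x))" using j by auto
      also have "\<dots> \<le> (\<Sum>i\<in>?I. card (g i))" by (rule sum_mono2) (use i j in auto)
      finally have "card (g i) + card (g j) \<le> k" using k by simp
      moreover have "card (g j) > 0" using card_lower_dsc_pos g j by (auto simp: PiE_iff)
      ultimately show ?thesis by simp
    next
      case False
      then have "card Q > 0" using level_one_memD(1)[OF Q] by (simp add: card_gt_0_iff)
      moreover have "card (g i) \<le> (\<Sum>i\<in>?I. card (g i))" by (rule member_le_sum) (use i in auto)
      ultimately show ?thesis using k by simp
    qed
    then have "g \<in> ?I \<rightarrow>\<^sub>E M" using g unfolding M_def by (auto simp: PiE_iff)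
    then show "P \<in> (\<lambda>(Q, g). graft n Q g) ` (SIGMA Q:level_one n. ({..<n} - \<Union>Q) \<rightarrow>\<^sub>E M)"
      using Q Pg by force
  qed
  moreover have "finite (SIGMA Q:level_one n. ({..<n} - \<Union>Q) \<rightarrow>\<^sub>E M)"
    using \<open>finite M\<close> by (intro finite_SigmaI finite_level_one finite_PiE) auto
  ultimately show ?case using finite_surj by blast
qed

section \<open>Generating functions\<close>

definition weight_fps :: "('a \<Rightarrow> nat) \<Rightarrow> 'a set \<Rightarrow> real fps" where
  "weight_fps w A = Abs_fps (\<lambda>k. real (card {a \<in> A. w a = k}))"

text \<open>\<open>card\<close> is \<open>0\<close> on infinite sets, so the product and sum rules
  for \<open>weight_fps\<close> are stated under this condition.\<close>

definition finite_levels :: "('a \<Rightarrow> nat) \<Rightarrow> 'a set \<Rightarrow> bool" where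
  "finite_levels w A \<longleftrightarrow> (\<forall>k. finite {a \<in> A. w a = k})"

lemma bij_betw_level:
  assumes "bij_betw h A B" "\<And>a. a \<in> A \<Longrightarrow> w' (h a) = w a"
  shows "bij_betw h {a \<in> A. w a = k} {b \<in> B. w' b = k}"
proof (rule bij_betw_subset[OF assms(1)])
  show "h ` {a \<in> A. w a = k} = {b \<in> B. w' b = k}"
    using assms by (auto simp: bij_betw_def)
qed auto

lemma weight_fps_bij_betw:
  assumes "bij_betw h A B" "\<And>a. a \<in> A \<Longrightarrow> w' (h a) = w a"
  shows "weight_fps w A = weight_fps w' B" "finite_levels w A \<longleftrightarrow> finite_levels w' B"
  unfolding weight_fps_def finite_levels_def
  using bij_betw_same_card[OF bij_betw_level[where h = h and A = A and B = B and w = w and w' = w']]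
    bij_betw_finite[OF bij_betw_level[where h = h and A = A and B = B and w = w and w' = w']] assms
  by auto

lemma level_Times:
  "{p \<in> A \<times> B. v (fst p) + w (snd p) = k} =
    (\<Union>i\<in>{0..k}. {a \<in> A. v a = i} \<times> {b \<in> B. w b = k - i})"
  for k :: nat
  by auto

lemma weight_fps_Times:
  assumes "finite_levels v A" "finite_levels w B"
  shows "weight_fps (\<lambda>p. v (fst p) + w (snd p)) (A \<times> B) = weight_fps v A * weight_fps w B"
    and "finite_levels (\<lambda>p. v (fst p) + w (snd p)) (A \<times> B)"
proof -
  have fin: "finite ({a \<in> A. v a = i} \<times> {b \<in> B. w b = j})" for i j
    using assms by (simp add: finite_levels_def)
  show "finite_levels (\<lambda>p. v (fst p) + w (snd p)) (A \<times> B)"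
    unfolding finite_levels_def level_Times using fin by auto
  have "card (\<Union>i\<in>{0..k}. {a \<in> A. v a = i} \<times> {b \<in> B. w b = k - i}) =
      (\<Sum>i\<in>{0..k}. card ({a \<in> A. v a = i} \<times> {b \<in> B. w b = k - i}))" for k
    by (rule card_UN_disjoint) (use fin in auto)
  then show "weight_fps (\<lambda>p. v (fst p) + w (snd p)) (A \<times> B) = weight_fps v A * weight_fps w B"
    by (intro fps_ext) (simp only: weight_fps_def level_Times fps_mult_nth fps_nth_Abs_fps
        card_cartesian_product of_nat_sum of_nat_mult)
qed

lemma weight_fps_PiE:
  assumes "finite I" "finite_levels w A"
  shows "weight_fps (\<lambda>g. \<Sum>i\<in>I. w (g i)) (I \<rightarrow>\<^sub>E A) = weight_fps w A ^ card I \<and>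
    finite_levels (\<lambda>g. \<Sum>i\<in>I. w (g i)) (I \<rightarrow>\<^sub>E A)"
  using assms(1)
proof (induction I)
  case empty
  have "{a. a = (\<lambda>x. undefined) \<and> 0 = k} = (if k = 0 then {\<lambda>x. undefined} else {})" for k :: nat
    by auto
  then show ?case by (auto simp: weight_fps_def finite_levels_def fps_eq_iff)
next
  case (insert j I)
  let ?W = "\<lambda>I g. \<Sum>i\<in>I. w (g i)" and ?h = "\<lambda>p. (snd p)(j := fst p)"
  have bij: "bij_betw ?h (A \<times> (I \<rightarrow>\<^sub>E A)) (insert j I \<rightarrow>\<^sub>E A)"
  proof (rule bij_betw_imageI)
    show "inj_on ?h (A \<times> (I \<rightarrow>\<^sub>E A))"
      using inj_combinator[OF insert.hyps(2), of "\<lambda>_. A"] by (simp add: case_prod_unfold)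
    show "?h ` (A \<times> (I \<rightarrow>\<^sub>E A)) = (insert j I \<rightarrow>\<^sub>E A)"
      using PiE_insert_eq[of j I "\<lambda>_. A"] by (simp add: case_prod_unfold)
  qed
  have W: "?W (insert j I) (?h p) = w (fst p) + ?W I (snd p)" for p
  proof -
    have "(\<Sum>i\<in>I. w (if i = j then fst p else snd p i)) = ?W I (snd p)"
      using insert.hyps by (intro sum.cong) auto
    then show ?thesis using insert.hyps by simp
  qed
  have IH: "weight_fps (?W I) (I \<rightarrow>\<^sub>E A) = weight_fps w A ^ card I" "finite_levels (?W I) (I \<rightarrow>\<^sub>E A)"
    using insert.IH by blast+
  show ?case
    using weight_fps_bij_betw[where w' = "?W (insert j I)" and w = "\<lambda>p. w (fst p) + ?W I (snd p)", OF bij W]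
      weight_fps_Times[OF assms(2) IH(2)] IH(1) insert.hyps by simp
qed

lemma weight_fps_Sigma:
  assumes "finite E" "\<And>e. e \<in> E \<Longrightarrow> finite_levels (w e) (B e)"
  shows "weight_fps (\<lambda>p. v (fst p) + w (fst p) (snd p)) (Sigma E B) =
    (\<Sum>e\<in>E. fps_X ^ v e * weight_fps (w e) (B e))"
proof (rule fps_ext)
  fix k
  let ?L = "\<lambda>e. {b \<in> B e. v e + w e b = k}"
  have L: "?L e = (if k < v e then {} else {b \<in> B e. w e b = k - v e})" for e by auto
  then have fin: "finite (?L e)" if "e \<in> E" for e
    using assms(2)[OF that] by (simp add: finite_levels_def)
  have "{p \<in> Sigma E B. v (fst p) + w (fst p) (snd p) = k} = Sigma E ?L" by auto
  then have "weight_fps (\<lambda>p. v (fst p) + w (fst p) (snd p)) (Sigma E B) $ k = real (\<Sum>e\<in>E. card (?L e))"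
    using card_SigmaI[OF assms(1), of ?L] fin by (simp add: weight_fps_def)
  also have "\<dots> = (\<Sum>e\<in>E. (fps_X ^ v e * weight_fps (w e) (B e)) $ k)"
    unfolding of_nat_sum by (intro sum.cong refl) (simp add: fps_X_power_mult_nth weight_fps_def L)
  also have "\<dots> = (\<Sum>e\<in>E. fps_X ^ v e * weight_fps (w e) (B e)) $ k"
    by (simp add: fps_sum_nth)
  finally show "weight_fps (\<lambda>p. v (fst p) + w (fst p) (snd p)) (Sigma E B) $ k =
    (\<Sum>e\<in>E. fps_X ^ v e * weight_fps (w e) (B e)) $ k" .
qed

definition dsc_fps :: "nat \<Rightarrow> real fps" where
  "dsc_fps n = Abs_fps (\<lambda>k. real (num_lower_dsc n k))"

lemma dsc_fps_eq: "dsc_fps n = weight_fps card (lower_dscs n)"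
  by (simp add: dsc_fps_def weight_fps_def num_lower_dsc_eq)

lemma dsc_fps_0: "dsc_fps n $ 0 = 0"
proof -
  have "{P \<in> lower_dscs n. card P = 0} = {}" using card_lower_dsc_pos by force
  then show ?thesis
    by (simp only: dsc_fps_eq weight_fps_def fps_nth_Abs_fps card.empty of_nat_0)
qed

text \<open>By \<open>card_graft\<close> the number of blocks is additive along the bijection
  \<open>graft\<close>, so each uncoloured child contributes one factor \<open>dsc_fps n\<close>,
  independently of the others.\<close>

theorem dsc_fps_recursion:
  assumes "n \<ge> 2"
  shows "dsc_fps n = (\<Sum>Q\<in>level_one n. fps_X ^ card Q * dsc_fps n ^ card ({..<n} - \<Union>Q))"
proof -
  have fin: "finite_levels card (lower_dscs n)"
    using finite_lower_dscs[OF assms] by (simp add: finite_levels_def)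
  note P = weight_fps_PiE[OF finite_Diff[OF finite_lessThan] fin]
  have "dsc_fps n = weight_fps (\<lambda>p. card (fst p) + (\<Sum>i\<in>{..<n} - \<Union>(fst p). card (snd p i))) (graft_args n)"
    unfolding dsc_fps_eq
  proof (rule weight_fps_bij_betw(1)[symmetric])
    show "bij_betw (\<lambda>(Q, g). graft n Q g) (graft_args n) (lower_dscs n)"
      using assms by (intro bij_betw_graft) simp
    fix p assume "p \<in> graft_args n"
    then show "card (case p of (Q, g) \<Rightarrow> graft n Q g) =
        card (fst p) + (\<Sum>i\<in>{..<n} - \<Union>(fst p). card (snd p i))"
      using assms card_graft[of n] by (auto simp: graft_args_def)
  qed
  also have "\<dots> = (\<Sum>Q\<in>level_one n. fps_X ^ card Q *
      weight_fps (\<lambda>g. \<Sum>i\<in>{..<n} - \<Union>Q. card (g i)) (({..<n} - \<Union>Q) \<rightarrow>\<^sub>E lower_dscs n))"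
    unfolding graft_args_def
    using P by (intro weight_fps_Sigma finite_level_one) blast
  also have "\<dots> = (\<Sum>Q\<in>level_one n. fps_X ^ card Q * dsc_fps n ^ card ({..<n} - \<Union>Q))"
    unfolding dsc_fps_eq using P by simp
  finally show ?thesis .
qed

section \<open>Coefficient bounds from a first-order pole of the derivative\<close>

text \<open>For \<open>x = pi * t \<le> 2\<close> the Taylor bound
  \<open>sin x \<ge> x - x ^ 3 / 6\<close> gives \<open>sin x \<ge> x / 3\<close>, and
  \<open>pi > 3\<close>.\<close>

lemma sin_pi_ge:
  fixes t :: real
  assumes "0 \<le> t" "t \<le> 1/2"
  shows "t \<le> sin (pi * t)"
proof -
  define x where "x = pi * t"
  have x: "0 \<le> x" "x \<le> 2"
    using assms pi_less_4 mult_mono[of pi 4 t "1/2"] by (auto simp: x_def)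
  have "\<bar>sin x - (\<Sum>m<3. sin_coeff m * x ^ m)\<bar> \<le> inverse (fact 3) * \<bar>x\<bar> ^ 3"
    by (rule Maclaurin_sin_bound)
  also have "(\<Sum>m<3. sin_coeff m * x ^ m) = x"
    by (simp add: numeral_3_eq_3 sin_coeff_def)
  also have "inverse (fact 3) * \<bar>x\<bar> ^ 3 = x * (x * x) / 6"
    using x by (simp add: fact_numeral power3_eq_cube)
  also have "\<dots> \<le> x * (2 * 2) / 6"
    using x by (intro divide_right_mono mult_left_mono mult_mono) auto
  finally have "x / 3 \<le> sin x" by (simp add: abs_if split: if_splits)
  moreover have "t \<le> x / 3"
    using assms pi_gt3 by (simp add: x_def) (metis less_eq_real_def mult.commute mult_left_mono)
  ultimately show ?thesis by (simp add: x_def)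
qed

lemma norm_one_minus_circle:
  "(norm (1 - of_real r * exp (2 * of_real pi * \<i> * of_real t)))\<^sup>2 =
    (1 - r)\<^sup>2 + 4 * r * (sin (pi * t))\<^sup>2"
proof -
  have e: "exp (2 * of_real pi * \<i> * of_real t) = cis (2 * (pi * t))"
    by (simp add: cis_conv_exp mult_ac)
  have s: "(cos (pi * t))\<^sup>2 + (sin (pi * t))\<^sup>2 = 1" by simp
  have "(norm (1 - of_real r * cis (2 * (pi * t))))\<^sup>2 =
      (1 - r * cos (2 * (pi * t)))\<^sup>2 + (r * sin (2 * (pi * t)))\<^sup>2"
    by (simp add: cmod_power2)
  also have "\<dots> = 1 - 2 * r * cos (2 * (pi * t)) + r\<^sup>2 * ((cos (2 * (pi * t)))\<^sup>2 + (sin (2 * (pi * t)))\<^sup>2)"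
    by algebra
  also have "\<dots> = 1 - 2 * r * cos (2 * (pi * t)) + r\<^sup>2" by simp
  also have "cos (2 * (pi * t)) = 1 - 2 * (sin (pi * t))\<^sup>2"
    by (rule cos_double_sin)
  finally show ?thesis unfolding e by (simp add: power2_eq_square algebra_simps)
qed

text \<open>The distance to \<open>1\<close> is at least half of \<open>1 - r\<close> plus the
  distance from \<open>t\<close> to the nearer end of the unit interval; \<open>r \<ge> 1/2\<close>
  keeps the factor \<open>4 * r\<close> at least \<open>2\<close>. Adding the terms for both ends
  gives one majorant on the whole circle with an elementary primitive.\<close>

lemma inverse_norm_one_minus_circle:
  assumes r: "1/2 \<le> r" "r < 1" and t: "0 \<le> t" "t \<le> 1"
  shows "1 / norm (1 - of_real r * exp (2 * of_real pi * \<i> * of_real t)) \<le>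
    2 * (1 / ((1 - r) + t) + 1 / ((1 - r) + (1 - t)))" (is "1 / ?N \<le> _")
proof -
  define N where "N = ?N"
  have key: "1 / N \<le> 2 / ((1 - r) + u)" if u: "0 \<le> u" "u \<le> sin (pi * t)" for u
  proof -
    have "((1 - r) + u)\<^sup>2 \<le> 4 * ((1 - r)\<^sup>2 + 4 * r * u\<^sup>2)"
    proof -
      have "2 * u\<^sup>2 \<le> 4 * r * u\<^sup>2" using r by (intro mult_right_mono) auto
      moreover have "((1 - r) + u)\<^sup>2 \<le> 2 * (1 - r)\<^sup>2 + 2 * u\<^sup>2"
        using zero_le_power2[of "(1 - r) - u"] by (simp add: power2_eq_square algebra_simps)
      moreover have "(1 - r)\<^sup>2 \<ge> 0" "u\<^sup>2 \<ge> 0" by auto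
      moreover have "a \<le> 4 * (b + d)" if "2 * c \<le> d" "a \<le> 2 * b + 2 * c" "b \<ge> 0" "c \<ge> 0"
        for a b c d :: real
        using that by argo
      ultimately show ?thesis by blast
    qed
    also have "\<dots> \<le> 4 * ((1 - r)\<^sup>2 + 4 * r * (sin (pi * t))\<^sup>2)"
      using u r by (intro mult_left_mono add_left_mono power_mono) auto
    also have "\<dots> = (2 * N)\<^sup>2" unfolding power_mult_distrib N_def norm_one_minus_circle by simp
    finally have "(1 - r) + u \<le> 2 * N" by (rule power2_le_imp_le) (simp add: N_def)
    then have "1 / N \<le> 1 / (((1 - r) + u) / 2)"
      using r u by (intro frac_le) auto
    then show ?thesis by simp
  qed
  show ?thesis
  proof (cases "t \<le> 1/2")
    case True
    have "1 / N \<le> 2 / ((1 - r) + t)" using key t True sin_pi_ge by blast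
    moreover have "0 \<le> 1 / ((1 - r) + (1 - t))" using r t by simp
    ultimately show ?thesis unfolding N_def[symmetric]
      by (simp only: distrib_left times_divide_eq_right mult_1_right)
  next
    case False
    have "sin (pi * t) = sin (pi * (1 - t))"
      by (simp add: right_diff_distrib)
    then have "1 - t \<le> sin (pi * t)" using sin_pi_ge[of "1 - t"] t False by simp
    then have "1 / N \<le> 2 / ((1 - r) + (1 - t))" using key[of "1 - t"] t by linarith
    moreover have "0 \<le> 1 / ((1 - r) + t)" using r t by simp
    ultimately show ?thesis unfolding N_def[symmetric]
      by (simp only: distrib_left times_divide_eq_right mult_1_right)
  qed
qed

text \<open>Cauchy's integral over the circle of radius \<open>r\<close>: the first-order pole in
  the bound integrates to a logarithm of the distance of that circle from \<open>1\<close>.\<close>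

lemma higher_deriv_bound_log:
  assumes hol: "g holomorphic_on ball 0 1"
    and K: "\<And>z. norm z < 1 \<Longrightarrow> norm (g z) \<le> K / norm (1 - z)" "K \<ge> 0"
    and r: "1/2 \<le> r" "r < 1"
  shows "norm ((deriv ^^ k) g 0 / fact k) * r ^ k \<le> 4 * K * ln ((2 - r) / (1 - r))"
proof -
  define e where "e = (\<lambda>x. exp (2 * of_real pi * \<i> * of_real x :: complex))"
  define f where "f = (\<lambda>x. g (of_real r * e x) / (of_real r * e x) ^ Suc k * (2 * pi * \<i> * of_real r * e x))"
  define I where "I = 2 * pi * \<i> / fact k * (deriv ^^ k) g 0"
  have ne: "norm (e x) = 1" for x by (simp add: e_def norm_exp_eq_Re)
  have "((\<lambda>u. g u / (u - 0) ^ Suc k) has_contour_integral I) (circlepath 0 r)"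
    unfolding I_def
  proof (rule Cauchy_has_contour_integral_higher_derivative_circlepath)
    show "continuous_on (cball 0 r) g"
      by (rule continuous_on_subset[OF holomorphic_on_imp_continuous_on[OF hol]]) (use r in auto)
    show "g holomorphic_on ball 0 r"
      by (rule holomorphic_on_subset[OF hol]) (use r in auto)
  qed (use r in auto)
  then have int: "(f has_integral I) {0..1}"
    unfolding has_contour_integral_def
  proof (rule has_integral_eq[rotated])
    fix x :: real assume "x \<in> {0..1}"
    then have "vector_derivative (circlepath 0 r) (at x within {0..1}) = 2 * pi * \<i> * of_real r * e x"
      by (simp add: e_def vector_derivative_circlepath01)
    moreover have "circlepath 0 r x = of_real r * e x" by (simp add: e_def circlepath)
    ultimately show "g (circlepath 0 r x) / (circlepath 0 r x - 0) ^ Suc k *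
        vector_derivative (circlepath 0 r) (at x within {0..1}) = f x"
      by (simp only: f_def diff_zero)
  qed
  define C where "C = 2 * pi * K / r ^ k"
  \<comment> \<open>\<open>B\<close> majorises the integrand and \<open>A\<close> is its primitive;
    the two ends of the interval contribute equally to \<open>A 1 - A 0\<close>.\<close>
  define B where "B = (\<lambda>x. C * (2 * (1 / ((1 - r) + x) + 1 / ((1 - r) + (1 - x)))))"
  define A where "A = (\<lambda>x. C * (2 * (ln ((1 - r) + x) - ln ((1 - r) + (1 - x)))))"
  have intB: "(B has_integral (A 1 - A 0)) {0..1}"
  proof (rule fundamental_theorem_of_calculus)
    fix x :: real assume "x \<in> {0..1}"
    then have "(A has_real_derivative B x) (at x within {0..1})"
      unfolding A_def B_def using r by (auto intro!: derivative_eq_intros simp: field_simps)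
    then show "(A has_vector_derivative B x) (at x within {0..1})"
      by (simp add: has_real_derivative_iff_has_vector_derivative)
  qed simp
  have "norm (f x) \<le> B x" if "x \<in> {0..1}" for x
  proof -
    have "norm (f x) = norm (g (of_real r * e x)) * (2 * pi) / r ^ k"
      unfolding f_def using r ne[of x] by (auto simp: norm_mult norm_divide norm_power)
    also have "\<dots> \<le> (K * (1 / norm (1 - of_real r * e x))) * (2 * pi) / r ^ k"
      using K(1)[of "of_real r * e x"] r
      by (intro divide_right_mono mult_right_mono) (auto simp: norm_mult ne)
    also have "\<dots> \<le> (K * (2 * (1 / ((1 - r) + x) + 1 / ((1 - r) + (1 - x))))) * (2 * pi) / r ^ k"
      using inverse_norm_one_minus_circle[OF r, of x] that r K(2) unfolding e_def
      by (intro divide_right_mono mult_right_mono mult_left_mono) auto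
    also have "\<dots> = B x" by (simp add: B_def C_def)
    finally show ?thesis .
  qed
  then have "norm (integral {0..1} f) \<le> integral {0..1} B"
    using int intB by (intro integral_norm_bound_integral) blast+
  then have "norm I \<le> A 1 - A 0" using int intB by (simp add: integral_unique)
  also have "A 1 - A 0 = 2 * pi * (4 * K * ln ((2 - r) / (1 - r))) / r ^ k"
    using r by (simp add: A_def C_def ln_div field_simps)
  finally have "2 * pi * norm ((deriv ^^ k) g 0 / fact k) \<le> 2 * pi * (4 * K * ln ((2 - r) / (1 - r))) / r ^ k"
    by (simp add: I_def norm_mult norm_divide)
  then show ?thesis using r by (simp add: field_simps)
qed

lemma sums_imp_higher_deriv:
  fixes c :: "nat \<Rightarrow> complex"
  assumes "\<And>z. norm z < 1 \<Longrightarrow> (\<lambda>k. c k * z ^ k) sums h z"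
  shows "c k = (deriv ^^ k) h 0 / fact k"
proof -
  have "(\<lambda>k. c k * (1/2) ^ k) sums h (1/2)" by (rule assms) simp
  then have "conv_radius c \<ge> norm (1/2 :: complex)"
    by (intro conv_radius_geI) (simp add: sums_iff)
  then have rad: "fps_conv_radius (Abs_fps c) > 0"
    by (simp add: fps_conv_radius_def less_le_trans[of 0 "ereal (1/2)"])
  have "eventually (\<lambda>z. z \<in> ball 0 1) (nhds (0::complex))"
    by (rule eventually_nhds_in_open) auto
  then have "eventually (\<lambda>z. eval_fps (Abs_fps c) z = h z) (nhds 0)"
    by eventually_elim (use assms in \<open>simp add: eval_fps_def sums_iff\<close>)
  with rad have "h has_fps_expansion Abs_fps c"
    by (simp add: has_fps_expansion_def)
  from fps_nth_fps_expansion[OF this, of k] show ?thesis by simp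
qed

text \<open>The derivative has \<open>k\<close>-th coefficient \<open>(k + 1) * c (k + 1)\<close>,
  hence the division by \<open>Suc k\<close>. The radius \<open>1 - 1 / (k + 2)\<close> gives
  \<open>(1 / r) ^ k \<le> exp 1 \<le> 3\<close> and turns the logarithm into
  \<open>ln (k + 3)\<close>; taking \<open>k + 2\<close> and not \<open>k + 1\<close> keeps
  \<open>r \<ge> 1/2\<close> at \<open>k = 0\<close>. The constant \<open>12\<close> is
  \<open>3 * 4\<close>.\<close>

lemma coeff_bound_log:
  fixes c :: "nat \<Rightarrow> complex"
  assumes sums: "\<And>z. norm z < 1 \<Longrightarrow> (\<lambda>k. c k * z ^ k) sums h z"
    and der: "\<And>z. norm z < 1 \<Longrightarrow> (h has_field_derivative h' z) (at z)"
    and K: "\<And>z. norm z < 1 \<Longrightarrow> norm (h' z) \<le> K / norm (1 - z)" "K \<ge> 0"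
  shows "norm (c (Suc k)) \<le> 12 * K * ln (real k + 3) / real (Suc k)"
proof -
  define m where "m = real k + 2"
  define r where "r = 1 - 1 / m"
  have m: "m \<ge> 2" by (simp add: m_def)
  then have r: "1/2 \<le> r" "r < 1" by (auto simp: r_def field_simps)
  have hol: "h holomorphic_on ball 0 1"
    using der by (intro holomorphic_onI) (auto simp: field_differentiable_def intro: has_field_derivative_at_within)
  have dh: "deriv h z = h' z" if "norm z < 1" for z using der[OF that] by (rule DERIV_imp_deriv)
  have "c (Suc k) = (deriv ^^ Suc k) h 0 / fact (Suc k)"
    using sums by (rule sums_imp_higher_deriv)
  also have "(deriv ^^ Suc k) h = (deriv ^^ k) (deriv h)"
    by (simp add: funpow_Suc_right del: funpow.simps(2))
  finally have "c (Suc k) * of_nat (Suc k) = (deriv ^^ k) (deriv h) 0 / fact k"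
    by (simp add: field_simps del: of_nat_Suc)
  then have "norm (c (Suc k)) * real (Suc k) = norm ((deriv ^^ k) (deriv h) 0 / fact k)"
    by (metis norm_mult norm_of_nat)
  moreover have "norm ((deriv ^^ k) (deriv h) 0 / fact k) * r ^ k \<le> 4 * K * ln ((2 - r) / (1 - r))"
    using K r hol dh by (intro higher_deriv_bound_log holomorphic_deriv) auto
  moreover have "(2 - r) / (1 - r) = real k + 3" using m by (simp add: r_def m_def field_simps)
  ultimately have 1: "norm (c (Suc k)) * real (Suc k) * r ^ k \<le> 4 * K * ln (real k + 3)" by simp
  have "(1 / r) ^ k \<le> exp (1 / (real k + 1)) ^ k"
  proof (rule power_mono)
    have "1 / r = 1 + 1 / (real k + 1)" using m by (simp add: r_def m_def field_simps)
    then show "1 / r \<le> exp (1 / (real k + 1))" using exp_ge_add_one_self by metis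
  qed (use r in auto)
  also have "\<dots> = exp (real k / (real k + 1))" by (simp flip: exp_of_nat_mult)
  also have "\<dots> \<le> exp 1" by simp
  also have "\<dots> \<le> 3" by (rule exp_le)
  finally have 2: "1 \<le> 3 * r ^ k" using r by (simp add: power_divide field_simps)
  have "norm (c (Suc k)) * real (Suc k) \<le> norm (c (Suc k)) * real (Suc k) * (3 * r ^ k)"
    using mult_left_mono[OF 2, of "norm (c (Suc k)) * real (Suc k)"] by simp
  also have "\<dots> \<le> 3 * (4 * K * ln (real k + 3))" using 1 by (simp add: mult_ac)
  finally show ?thesis by (simp add: field_simps)
qed

section \<open>Tame functions on the closed disc\<close>

text \<open>The derivative is integrated along the straight segment from \<open>z\<close> to
  \<open>1\<close>, on which \<open>norm (1 - p)\<close> decreases linearly; continuity takes care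
  of the endpoint. Asking for the bound only at points no farther from \<open>1\<close> than
  \<open>z\<close> allows purely local information near \<open>1\<close>.\<close>

lemma segment_bound:
  fixes f :: "complex \<Rightarrow> complex"
  assumes z: "norm z < 1" and cont: "continuous_on (cball 0 1) f" and q: "q > 0"
    and der: "\<And>p. norm p < 1 \<Longrightarrow> norm (1 - p) \<le> norm (1 - z) \<Longrightarrow> (f has_field_derivative f' p) (at p)"
    and bnd: "\<And>p. norm p < 1 \<Longrightarrow> norm (1 - p) \<le> norm (1 - z) \<Longrightarrow>
      norm (f' p) \<le> K * norm (1 - p) powr (q - 1)"
  shows "norm (f 1 - f z) \<le> K / q * norm (1 - z) powr q"
proof -
  define N where "N = norm (1 - z)"
  have N: "N > 0" using z by (auto simp: N_def)
  define p where "p = (\<lambda>t. z + of_real t * (1 - z))"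
  \<comment> \<open>A primitive of the bound on the derivative along the segment; it vanishes at
    \<open>t = 1\<close> because \<open>q > 0\<close>.\<close>
  define \<phi> where "\<phi> = (\<lambda>t. - (K / q) * N powr q * (1 - t) powr q)"
  have one_p: "1 - p t = of_real (1 - t) * (1 - z)" for t by (simp add: p_def algebra_simps)
  have norm_p: "norm (1 - p t) = (1 - t) * N" if "t \<le> 1" for t
    using that unfolding one_p norm_mult N_def norm_of_real by simp
  have p_lt: "norm (p t) < 1" if "0 \<le> t" "t < 1" for t
  proof -
    have "p t = of_real (1 - t) * z + of_real t" by (simp add: p_def algebra_simps)
    also have "norm \<dots> \<le> (1 - t) * norm z + t"
      using that norm_triangle_ineq[of "of_real (1 - t) * z" "of_real t :: complex"]
      unfolding norm_mult norm_of_real by simp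
    also have "\<dots> < (1 - t) * 1 + t" using that z by (intro add_strict_right_mono mult_strict_left_mono) auto
    finally show ?thesis by simp
  qed
  have le: "norm (1 - p t) \<le> norm (1 - z)" if "0 \<le> t" "t \<le> 1" for t
    using that N norm_p[of t] by (simp add: N_def[symmetric])
  have "norm ((f \<circ> p) 1 - (f \<circ> p) 0) \<le> \<phi> 1 - \<phi> 0"
  proof (rule differentiable_bound_general[where f' = "\<lambda>t. (1 - z) * f' (p t)" and \<phi>' = "\<lambda>t. K * N powr q * (1 - t) powr (q - 1)"])
    have "p ` {0..1} \<subseteq> cball 0 1"
    proof
      fix w assume "w \<in> p ` {0..1}"
      then obtain t where t: "t \<in> {0..1}" "w = p t" by blast
      show "w \<in> cball 0 1"
      proof (cases "t = 1")
        case True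
        then show ?thesis using t by (simp add: p_def)
      next
        case False
        then show ?thesis using t p_lt[of t] by simp
      qed
    qed
    moreover have "continuous_on {0..1} p" unfolding p_def by (intro continuous_intros)
    ultimately show "continuous_on {0..1} (f \<circ> p)"
      by (intro continuous_on_compose continuous_on_subset[OF cont])
    show "continuous_on {0..1} \<phi>"
      unfolding \<phi>_def using q by (intro continuous_intros continuous_on_powr') auto
  next
    fix t :: real assume t: "0 < t" "t < 1"
    have "(p has_vector_derivative (1 - z)) (at t)"
      unfolding p_def by (auto intro!: derivative_eq_intros)
    moreover have "(f has_field_derivative f' (p t)) (at (p t))"
      using t by (intro der p_lt le) auto
    ultimately show "((f \<circ> p) has_vector_derivative (1 - z) * f' (p t)) (at t)"
      by (rule field_vector_diff_chain_at)
    show "(\<phi> has_vector_derivative K * N powr q * (1 - t) powr (q - 1)) (at t)"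
      unfolding has_real_derivative_iff_has_vector_derivative[symmetric] \<phi>_def
      using t q by (auto intro!: derivative_eq_intros simp: powr_diff)
    have "norm ((1 - z) * f' (p t)) \<le> N * (K * ((1 - t) * N) powr (q - 1))"
      using bnd[OF p_lt le, of t] norm_p[of t] t N unfolding norm_mult N_def[symmetric]
      by (intro mult_left_mono) auto
    also have "\<dots> = K * N powr q * (1 - t) powr (q - 1)"
      using t N by (simp add: powr_mult powr_diff)
    finally show "norm ((1 - z) * f' (p t)) \<le> K * N powr q * (1 - t) powr (q - 1)" .
  qed simp
  then show ?thesis by (simp add: p_def \<phi>_def N_def)
qed

text \<open>At worst a square-root singularity at \<open>1\<close>. Such functions form an algebra,
  so tameness passes from \<open>F\<close> to all polynomials in \<open>z\<close> and
  \<open>F\<close>.\<close>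

definition tame :: "(complex \<Rightarrow> complex) \<Rightarrow> bool" where
  "tame h \<longleftrightarrow> continuous_on (cball 0 1) h \<and>
    (\<exists>h' K. \<forall>z. norm z < 1 \<longrightarrow> (h has_field_derivative h' z) (at z) \<and>
      norm (h' z) \<le> K / sqrt (norm (1 - z)))"

lemma tameI:
  assumes "continuous_on (cball 0 1) h"
    and "\<And>z. norm z < 1 \<Longrightarrow> (h has_field_derivative h' z) (at z)"
    and "\<And>z. norm z < 1 \<Longrightarrow> norm (h' z) \<le> K / sqrt (norm (1 - z))"
  shows "tame h"
  using assms unfolding tame_def by blast

lemma tameE:
  assumes "tame h"
  obtains K h' where "K \<ge> 0" "\<And>z. norm z < 1 \<Longrightarrow> (h has_field_derivative h' z) (at z)"
    "\<And>z. norm z < 1 \<Longrightarrow> norm (h' z) \<le> K / sqrt (norm (1 - z))"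
proof -
  from assms obtain h' K where h: "\<forall>z. norm z < 1 \<longrightarrow> (h has_field_derivative h' z) (at z) \<and>
      norm (h' z) \<le> K / sqrt (norm (1 - z))" unfolding tame_def by blast
  have "norm (h' 0) \<le> K / sqrt (norm (1 - 0 :: complex))" using h by (metis norm_zero zero_less_one)
  then have "norm (h' 0) \<le> K" by simp
  then have "K \<ge> 0" by (rule order.trans[OF norm_ge_zero])
  then show ?thesis using that h by blast
qed

lemma tame_bounded:
  assumes "tame h"
  obtains M where "M \<ge> 0" "\<And>z. norm z \<le> 1 \<Longrightarrow> norm (h z) \<le> M"
proof -
  have "compact (h ` cball 0 1)"
    using assms unfolding tame_def by (intro compact_continuous_image) auto
  then have "bounded (h ` cball 0 1)" by (rule compact_imp_bounded)
  then obtain M where "\<forall>y\<in>h ` cball 0 1. norm y \<le> M" unfolding bounded_iff by blast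
  then have "norm (h z) \<le> M" if "norm z \<le> 1" for z using that by simp
  moreover from this[of 0] have "M \<ge> 0" using order.trans[OF norm_ge_zero] by fastforce
  ultimately show ?thesis using that by blast
qed

lemma norm_one_minus_lt_2: "norm z < 1 \<Longrightarrow> 0 < norm (1 - z) \<and> norm (1 - z) < 2" for z :: complex
  using norm_triangle_ineq4[of 1 z] by auto

lemma tame_const: "tame (\<lambda>_. c)"
  by (rule tameI[where h' = "\<lambda>_. 0" and K = 0]) auto

lemma tame_ident: "tame (\<lambda>z. z)"
proof (rule tameI[where h' = "\<lambda>_. 1" and K = 2])
  fix z :: complex assume "norm z < 1"
  then have "0 < norm (1 - z)" "norm (1 - z) < 2" using norm_one_minus_lt_2 by blast+
  moreover from this have "sqrt (norm (1 - z)) \<le> 2" by (intro real_le_lsqrt) auto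
  ultimately show "norm (1 :: complex) \<le> 2 / sqrt (norm (1 - z))" by simp
qed (auto intro!: derivative_eq_intros continuous_intros)

lemma tame_add:
  assumes "tame f" "tame g" shows "tame (\<lambda>z. f z + g z)"
proof -
  obtain K f' where f: "K \<ge> 0" "\<And>z. norm z < 1 \<Longrightarrow> (f has_field_derivative f' z) (at z)"
    "\<And>z. norm z < 1 \<Longrightarrow> norm (f' z) \<le> K / sqrt (norm (1 - z))" using tameE[OF assms(1)] by blast
  obtain L g' where g: "L \<ge> 0" "\<And>z. norm z < 1 \<Longrightarrow> (g has_field_derivative g' z) (at z)"
    "\<And>z. norm z < 1 \<Longrightarrow> norm (g' z) \<le> L / sqrt (norm (1 - z))" using tameE[OF assms(2)] by blast
  show ?thesis
  proof (rule tameI[where h' = "\<lambda>z. f' z + g' z" and K = "K + L"])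
    fix z :: complex assume z: "norm z < 1"
    then show "((\<lambda>z. f z + g z) has_field_derivative f' z + g' z) (at z)"
      by (intro derivative_intros f g)
    show "norm (f' z + g' z) \<le> (K + L) / sqrt (norm (1 - z))"
      unfolding add_divide_distrib by (rule norm_triangle_le) (intro add_mono f g z)
  qed (use assms in \<open>auto simp: tame_def intro!: continuous_intros\<close>)
qed

lemma tame_mult:
  assumes "tame f" "tame g" shows "tame (\<lambda>z. f z * g z)"
proof -
  obtain K f' where f: "K \<ge> 0" "\<And>z. norm z < 1 \<Longrightarrow> (f has_field_derivative f' z) (at z)"
    "\<And>z. norm z < 1 \<Longrightarrow> norm (f' z) \<le> K / sqrt (norm (1 - z))" using tameE[OF assms(1)] by blast
  obtain L g' where g: "L \<ge> 0" "\<And>z. norm z < 1 \<Longrightarrow> (g has_field_derivative g' z) (at z)"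
    "\<And>z. norm z < 1 \<Longrightarrow> norm (g' z) \<le> L / sqrt (norm (1 - z))" using tameE[OF assms(2)] by blast
  obtain M where M: "M \<ge> 0" "\<And>z. norm z \<le> 1 \<Longrightarrow> norm (f z) \<le> M" using tame_bounded[OF assms(1)] by blast
  obtain M' where M': "M' \<ge> 0" "\<And>z. norm z \<le> 1 \<Longrightarrow> norm (g z) \<le> M'" using tame_bounded[OF assms(2)] by blast
  show ?thesis
  proof (rule tameI[where h' = "\<lambda>z. f' z * g z + g' z * f z" and K = "K * M' + L * M"])
    fix z :: complex assume z: "norm z < 1"
    then show "((\<lambda>z. f z * g z) has_field_derivative f' z * g z + g' z * f z) (at z)"
      by (intro derivative_intros f g)
    have "norm (f' z * g z) \<le> K / sqrt (norm (1 - z)) * M'"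
      unfolding norm_mult using z f(1) M' by (intro mult_mono f(3)) auto
    moreover have "norm (g' z * f z) \<le> L / sqrt (norm (1 - z)) * M"
      unfolding norm_mult using z g(1) M by (intro mult_mono g(3)) auto
    ultimately show "norm (f' z * g z + g' z * f z) \<le> (K * M' + L * M) / sqrt (norm (1 - z))"
      using norm_triangle_ineq[of "f' z * g z" "g' z * f z"] by (simp add: add_divide_distrib)
  qed (use assms in \<open>auto simp: tame_def intro!: continuous_intros\<close>)
qed

lemma tame_power: "tame f \<Longrightarrow> tame (\<lambda>z. f z ^ k)"
  by (induction k) (auto intro: tame_const tame_mult)

lemma tame_sum: "(\<And>i. i \<in> I \<Longrightarrow> tame (f i)) \<Longrightarrow> tame (\<lambda>z. \<Sum>i\<in>I. f i z)"
  by (induction I rule: infinite_finite_induct) (auto intro: tame_const tame_add)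

lemma tame_diff: "tame f \<Longrightarrow> tame g \<Longrightarrow> tame (\<lambda>z. f z - g z)"
  using tame_add[of f "\<lambda>z. - 1 * g z"] tame_mult[OF tame_const[of "-1"], of g] by simp

text \<open>\<open>segment_bound\<close> with \<open>q = 1/2\<close>: a derivative of inverse-root
  growth integrates to root growth.\<close>

lemma tame_diff_at_1:
  assumes "tame h"
  obtains K where "K \<ge> 0" "\<And>z. norm z < 1 \<Longrightarrow> norm (h z - h 1) \<le> K * sqrt (norm (1 - z))"
proof -
  obtain K h' where h: "K \<ge> 0" "\<And>z. norm z < 1 \<Longrightarrow> (h has_field_derivative h' z) (at z)"
    "\<And>z. norm z < 1 \<Longrightarrow> norm (h' z) \<le> K / sqrt (norm (1 - z))" using tameE[OF assms] by blast
  have "norm (h z - h 1) \<le> (2 * K) * sqrt (norm (1 - z))" if z: "norm z < 1" for z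
  proof -
    have "norm (h 1 - h z) \<le> K / (1/2) * norm (1 - z) powr (1/2)"
    proof (rule segment_bound[OF z, where f' = h'])
      fix p :: complex assume p: "norm p < 1"
      have "norm (1 - p) powr (1/2 - 1) = 1 / sqrt (norm (1 - p))"
        by (simp add: powr_minus_divide powr_half_sqrt)
      then show "norm (h' p) \<le> K * norm (1 - p) powr (1/2 - 1)" using h(3)[OF p] by simp
    qed (use assms h in \<open>auto simp: tame_def\<close>)
    then show ?thesis by (simp add: powr_half_sqrt norm_minus_commute mult_ac)
  qed
  with h(1) show ?thesis by (intro that[of "2 * K"]) auto
qed

section \<open>Square-root singularities\<close>

text \<open>A fixed-point equation rescaled to have its singularity at \<open>1\<close>, with the
  powers of the radius absorbed into \<open>c\<close>. \<open>critical\<close> says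
  \<open>\<Phi>\<^sub>w(1, \<tau>) = 1\<close>; \<open>linear\<close> keeps \<open>U\<close> from
  vanishing elsewhere on the circle, and \<open>nonlinear\<close> makes
  \<open>\<Phi>\<^sub>w\<^sub>w(1, \<tau>)\<close> positive.\<close>

locale critical_system =
  fixes E :: "'e set" and c :: "'e \<Rightarrow> real" and \<alpha> \<beta> :: "'e \<Rightarrow> nat" and a :: "nat \<Rightarrow> real"
    and F :: "complex \<Rightarrow> complex" and \<tau> :: real
  defines "F \<equiv> \<lambda>z. \<Sum>k. of_real (a k) * z ^ k" and "\<tau> \<equiv> suminf a"
  assumes finite_E: "finite E" and c_nonneg: "\<And>e. e \<in> E \<Longrightarrow> c e \<ge> 0"
    and a_nonneg: "\<And>k. a k \<ge> 0" and a_summable: "summable a"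
    and fixpoint: "\<And>z. norm z \<le> 1 \<Longrightarrow> F z = (\<Sum>e\<in>E. of_real (c e) * z ^ \<alpha> e * F z ^ \<beta> e)"
    and critical: "(\<Sum>e\<in>E. c e * real (\<beta> e) * \<tau> ^ (\<beta> e - 1)) = 1"
    and tau_pos: "\<tau> > 0"
    and linear: "\<exists>e\<in>E. c e > 0 \<and> \<alpha> e = 1 \<and> \<beta> e = 1"
    and nonlinear: "\<exists>e\<in>E. c e > 0 \<and> \<beta> e \<ge> 2"
begin

text \<open>With \<open>\<Phi>(z, w)\<close> the right-hand side of the fixed-point equation, \<open>A\<close>, \<open>1 - U\<close>, \<open>C\<close> and \<open>H\<close> are
  \<open>\<Phi>\<^sub>z\<close>, \<open>\<Phi>\<^sub>w\<close>, \<open>\<Phi>\<^sub>z\<^sub>w\<close> and \<open>\<Phi>\<^sub>w\<^sub>w\<close> at \<open>(z, F z)\<close>.\<close>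

definition A :: "complex \<Rightarrow> complex" where
  "A z = (\<Sum>e\<in>E. of_real (c e) * of_nat (\<alpha> e) * z ^ (\<alpha> e - 1) * F z ^ \<beta> e)"
definition U :: "complex \<Rightarrow> complex" where
  "U z = 1 - (\<Sum>e\<in>E. of_real (c e) * of_nat (\<beta> e) * z ^ \<alpha> e * F z ^ (\<beta> e - 1))"
definition C :: "complex \<Rightarrow> complex" where
  "C z = (\<Sum>e\<in>E. of_real (c e) * of_nat (\<alpha> e) * of_nat (\<beta> e) * z ^ (\<alpha> e - 1) * F z ^ (\<beta> e - 1))"
definition H :: "complex \<Rightarrow> complex" where
  "H z = (\<Sum>e\<in>E. of_real (c e) * of_nat (\<beta> e) * of_nat (\<beta> e - 1) * z ^ \<alpha> e * F z ^ (\<beta> e - 1 - 1))"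
definition F' :: "complex \<Rightarrow> complex" where
  "F' z = (\<Sum>k. diffs (\<lambda>k. of_real (a k)) k * z ^ k)"

definition A\<^sub>1 :: real where
  "A\<^sub>1 = (\<Sum>e\<in>E. c e * real (\<alpha> e) * \<tau> ^ \<beta> e)"
definition H\<^sub>1 :: real where
  "H\<^sub>1 = (\<Sum>e\<in>E. c e * real (\<beta> e) * real (\<beta> e - 1) * \<tau> ^ (\<beta> e - 1 - 1))"

lemma norm_term: "norm z \<le> 1 \<Longrightarrow> norm (of_real (a k) * z ^ k :: complex) \<le> a k"
  using a_nonneg[of k] by (simp add: norm_mult norm_power mult_left_le power_le_one)

lemma summable_term: "norm z \<le> 1 \<Longrightarrow> summable (\<lambda>k. of_real (a k) * z ^ k :: complex)"
  by (rule summable_comparison_test'[OF a_summable norm_term])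

lemma norm_F_le: "norm z \<le> 1 \<Longrightarrow> norm (F z) \<le> \<tau>"
  unfolding F_def \<tau>_def by (intro norm_suminf_le norm_term a_summable)

lemma F_1: "F 1 = of_real \<tau>"
  unfolding F_def \<tau>_def using suminf_of_real[OF a_summable, where 'a = complex] by simp

lemma continuous_F: "continuous_on (cball 0 1) F"
proof -
  have "uniform_limit (cball 0 1) (\<lambda>n z. \<Sum>i<n. of_real (a i) * z ^ i) F sequentially"
    unfolding F_def by (rule Weierstrass_m_test[OF _ a_summable]) (simp add: norm_term)
  then show ?thesis
    by (rule uniform_limit_theorem[rotated]) (auto intro!: always_eventually continuous_intros)
qed

lemma F'_sums: "norm z < 1 \<Longrightarrow> (\<lambda>k. diffs (\<lambda>k. of_real (a k)) k * z ^ k) sums F' z"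
  unfolding F'_def by (intro summable_sums termdiff_converges[where K = 1] summable_term) auto

lemma has_derivative_F:
  assumes "norm z < 1" shows "(F has_field_derivative F' z) (at z)"
proof -
  have "summable (\<lambda>k. complex_of_real (a k) * 1 ^ k)" by (rule summable_term) simp
  then show ?thesis unfolding F_def F'_def by (rule termdiffs_strong) (use assms in simp)
qed

lemma has_derivative_monomial:
  assumes "norm z < 1"
  shows "((\<lambda>z. k * z ^ i * F z ^ j) has_field_derivative
    k * of_nat i * z ^ (i - 1) * F z ^ j + k * of_nat j * z ^ i * F z ^ (j - 1) * F' z) (at z)"
  using has_derivative_F[OF assms] by (auto intro!: derivative_eq_intros)

text \<open>Implicit differentiation of the fixed-point equation. The product form is used because
  \<open>U z \<noteq> 0\<close> is established only later, with the help of this identity.\<close>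

lemma A_eq: assumes "norm z < 1" shows "F' z * U z = A z"
proof -
  have "(F has_field_derivative A z + (1 - U z) * F' z) (at z)"
  proof (rule DERIV_cong_ev[OF refl _ refl, THEN iffD2])
    show "eventually (\<lambda>z. F z = (\<Sum>e\<in>E. of_real (c e) * z ^ \<alpha> e * F z ^ \<beta> e)) (nhds z)"
    proof (rule eventually_mono[OF eventually_nhds_in_open[of "ball 0 1"]])
      fix w :: complex assume "w \<in> ball 0 1"
      then show "F w = (\<Sum>e\<in>E. of_real (c e) * w ^ \<alpha> e * F w ^ \<beta> e)" by (intro fixpoint) simp
    qed (use assms in auto)
    have "((\<lambda>z. \<Sum>e\<in>E. of_real (c e) * z ^ \<alpha> e * F z ^ \<beta> e) has_field_derivative
      (\<Sum>e\<in>E. of_real (c e) * of_nat (\<alpha> e) * z ^ (\<alpha> e - 1) * F z ^ \<beta> e +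
        of_real (c e) * of_nat (\<beta> e) * z ^ \<alpha> e * F z ^ (\<beta> e - 1) * F' z)) (at z)"
      by (intro DERIV_sum has_derivative_monomial assms)
    then show "((\<lambda>z. \<Sum>e\<in>E. of_real (c e) * z ^ \<alpha> e * F z ^ \<beta> e) has_field_derivative
        A z + (1 - U z) * F' z) (at z)"
      by (simp add: A_def U_def sum.distrib sum_distrib_right)
  qed
  then have "F' z = A z + (1 - U z) * F' z"
    using has_derivative_F[OF assms] DERIV_unique by blast
  then show ?thesis by (simp add: algebra_simps)
qed

lemma has_derivative_U:
  assumes "norm z < 1" shows "(U has_field_derivative - (C z + H z * F' z)) (at z)"
proof -
  have "(U has_field_derivative 0 -
    (\<Sum>e\<in>E. of_real (c e) * of_nat (\<beta> e) * of_nat (\<alpha> e) * z ^ (\<alpha> e - 1) * F z ^ (\<beta> e - 1) +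
      of_real (c e) * of_nat (\<beta> e) * of_nat (\<beta> e - 1) * z ^ \<alpha> e * F z ^ (\<beta> e - 1 - 1) * F' z)) (at z)"
    unfolding U_def by (intro DERIV_diff DERIV_const DERIV_sum has_derivative_monomial assms)
  then show ?thesis
    by (simp add: C_def H_def sum.distrib sum_distrib_left sum_distrib_right mult_ac)
qed

lemma continuous_U: "continuous_on (cball 0 1) U"
  unfolding U_def by (intro continuous_intros continuous_F)

lemma U_1: "U 1 = 0"
proof -
  have "U 1 = of_real (1 - (\<Sum>e\<in>E. c e * real (\<beta> e) * \<tau> ^ (\<beta> e - 1)))"
    unfolding U_def F_1 by simp
  then show ?thesis unfolding critical by simp
qed

lemma tau_nonneg: "\<tau> \<ge> 0"
  using tau_pos by simp

text \<open>The monomial \<open>z w\<close> alone bounds \<open>U\<close> away from \<open>0\<close> off the point \<open>1\<close>, which replaces the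
  usual aperiodicity argument.\<close>

lemma Re_U:
  obtains k where "k > 0" "\<And>z. norm z \<le> 1 \<Longrightarrow> Re (U z) \<ge> k * (1 - Re z)"
proof -
  obtain e\<^sub>1 where e1: "e\<^sub>1 \<in> E" "c e\<^sub>1 > 0" "\<alpha> e\<^sub>1 = 1" "\<beta> e\<^sub>1 = 1" using linear by blast
  have "Re (U z) \<ge> c e\<^sub>1 * (1 - Re z)" if z: "norm z \<le> 1" for z
  proof -
    let ?t = "\<lambda>e. c e * real (\<beta> e) * (\<tau> ^ (\<beta> e - 1) - Re (z ^ \<alpha> e * F z ^ (\<beta> e - 1)))"
    have "Re (of_real (c e) * of_nat (\<beta> e) * z ^ \<alpha> e * F z ^ (\<beta> e - 1)) =
        c e * real (\<beta> e) * Re (z ^ \<alpha> e * F z ^ (\<beta> e - 1))" for e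
    proof -
      have "of_real (c e) * of_nat (\<beta> e) * z ^ \<alpha> e * F z ^ (\<beta> e - 1) =
          of_real (c e * real (\<beta> e)) * (z ^ \<alpha> e * F z ^ (\<beta> e - 1))" by simp
      then show ?thesis by (simp only: Re_complex_of_real times_complex.sel Im_complex_of_real mult_zero_left diff_zero)
    qed
    then have "Re (U z) = (\<Sum>e\<in>E. c e * real (\<beta> e) * \<tau> ^ (\<beta> e - 1)) -
        (\<Sum>e\<in>E. c e * real (\<beta> e) * Re (z ^ \<alpha> e * F z ^ (\<beta> e - 1)))"
      unfolding U_def critical by simp
    also have "\<dots> = (\<Sum>e\<in>E. ?t e)" by (simp add: sum_subtractf right_diff_distrib)
    also have "(\<Sum>e\<in>{e\<^sub>1}. ?t e) \<le> \<dots>"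
    proof (rule sum_mono2)
      fix e assume e: "e \<in> E - {e\<^sub>1}"
      have "Re (z ^ \<alpha> e * F z ^ (\<beta> e - 1)) \<le> norm z ^ \<alpha> e * norm (F z) ^ (\<beta> e - 1)"
        using complex_Re_le_cmod[of "z ^ \<alpha> e * F z ^ (\<beta> e - 1)"] by (simp add: norm_mult norm_power)
      also have "\<dots> \<le> 1 * \<tau> ^ (\<beta> e - 1)"
        using z norm_F_le[OF z] tau_nonneg by (intro mult_mono power_mono power_le_one) auto
      finally show "0 \<le> ?t e" using c_nonneg e by simp
    qed (use finite_E e1 in auto)
    finally show ?thesis using e1 by simp
  qed
  with e1(2) show ?thesis by (rule that)
qed

lemma A_1: "A 1 = of_real A\<^sub>1" and H_1: "H 1 = of_real H\<^sub>1"
  unfolding A_def H_def A\<^sub>1_def H\<^sub>1_def F_1 by simp_all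

lemma A\<^sub>1_pos: "A\<^sub>1 > 0"
proof -
  obtain e where "e \<in> E" "c e > 0" "\<alpha> e = 1" using linear by blast
  then show ?thesis
    unfolding A\<^sub>1_def using finite_E c_nonneg tau_pos tau_nonneg by (intro sum_pos2[of E e]) auto
qed

lemma H\<^sub>1_pos: "H\<^sub>1 > 0"
proof -
  obtain e where "e \<in> E" "c e > 0" "\<beta> e \<ge> 2" using nonlinear by blast
  then show ?thesis
    unfolding H\<^sub>1_def using finite_E c_nonneg tau_pos tau_nonneg by (intro sum_pos2[of E e]) auto
qed

text \<open>The product \<open>\<Phi>\<^sub>w\<^sub>w \<Phi>\<^sub>z\<close> at the critical point;
  \<open>2 * \<gamma>\<close> is the slope of \<open>U\<^sup>2\<close> in
  \<open>1 - z\<close>.\<close>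

definition \<gamma> :: real where "\<gamma> = H\<^sub>1 * A\<^sub>1"

lemma \<gamma>_pos: "\<gamma> > 0"
  unfolding \<gamma>_def using A\<^sub>1_pos H\<^sub>1_pos by simp

definition R :: "complex \<Rightarrow> complex" where
  "R z = C z * U z + H z * A z"

lemma R_1: "R 1 = of_real \<gamma>"
  unfolding R_def U_1 A_1 H_1 \<gamma>_def by simp

text \<open>Squaring removes the unbounded \<open>F'\<close>: in \<open>U U'\<close> it occurs only
  multiplied by \<open>U\<close>, and that product is \<open>A\<close>.\<close>

lemma has_derivative_U_square:
  assumes "norm z < 1" shows "((\<lambda>z. U z ^ 2) has_field_derivative - 2 * R z) (at z)"
proof -
  have "((\<lambda>z. U z ^ 2) has_field_derivative 2 * U z * - (C z + H z * F' z)) (at z)"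
    using has_derivative_U[OF assms] by (auto intro!: derivative_eq_intros)
  moreover have "2 * U z * - (C z + H z * F' z) = - 2 * (C z * U z + H z * (F' z * U z))"
    by (simp add: algebra_simps)
  ultimately show ?thesis unfolding R_def A_eq[OF assms] by simp
qed

lemma continuous_R: "continuous_on (cball 0 1) R"
  unfolding R_def A_def C_def H_def by (intro continuous_intros continuous_F continuous_U)

text \<open>The exponent is left open because it is applied twice: with \<open>q = 1\<close>, when
  only continuity of \<open>R\<close> is known, and with \<open>q = 3/2\<close>, once
  \<open>R\<close> is known to be tame.\<close>

lemma U_square_expansion:
  assumes z: "norm z < 1" and q: "q > 0"
    and R: "\<And>p. norm p < 1 \<Longrightarrow> norm (1 - p) \<le> norm (1 - z) \<Longrightarrow>
      norm (R p - R 1) \<le> K * norm (1 - p) powr (q - 1)"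
  shows "norm (U z ^ 2 - of_real (2 * \<gamma>) * (1 - z)) \<le> 2 * K / q * norm (1 - z) powr q"
proof -
  let ?f = "\<lambda>w. U w ^ 2 - of_real (2 * \<gamma>) * (1 - w)"
  have "norm (?f 1 - ?f z) \<le> 2 * K / q * norm (1 - z) powr q"
  proof (rule segment_bound[OF z _ q, where f' = "\<lambda>w. - 2 * (R w - R 1)"])
    show "continuous_on (cball 0 1) ?f" by (intro continuous_intros continuous_U)
    fix p :: complex assume p: "norm p < 1" "norm (1 - p) \<le> norm (1 - z)"
    have "(?f has_field_derivative - 2 * R p - of_real (2 * \<gamma>) * (0 - 1)) (at p)"
      by (intro DERIV_diff DERIV_cmult has_derivative_U_square[OF p(1)] DERIV_const DERIV_ident)
    then show "(?f has_field_derivative - 2 * (R p - R 1)) (at p)"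
      unfolding R_1 by (simp add: algebra_simps)
    show "norm (- 2 * (R p - R 1)) \<le> 2 * K * norm (1 - p) powr (q - 1)"
      using R[OF p] unfolding norm_mult by simp
  qed
  then show ?thesis by (simp add: U_1 norm_minus_commute)
qed

text \<open>Near \<open>1\<close> the error in \<open>U\<^sup>2\<close> is at most
  \<open>\<gamma> |1 - z|\<close>, half of the main term. Away from \<open>1\<close>,
  \<open>Re_U\<close> applies together with
  \<open>|1 - z|\<^sup>2 \<le> 2 (1 - Re z)\<close>.\<close>

lemma norm_U_lower:
  obtains m where "m > 0" "\<And>z. norm z < 1 \<Longrightarrow> m * sqrt (norm (1 - z)) \<le> norm (U z)"
proof -
  obtain \<delta> where \<delta>: "\<delta> > 0" "\<And>p. norm p \<le> 1 \<Longrightarrow> dist p 1 < \<delta> \<Longrightarrow> dist (R p) (R 1) < \<gamma> / 2"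
    using continuous_R \<gamma>_pos unfolding continuous_on_iff
    by (metis centre_in_cball half_gt_zero mem_cball_0 norm_one order_refl)
  obtain k where k: "k > 0" "\<And>z. norm z \<le> 1 \<Longrightarrow> Re (U z) \<ge> k * (1 - Re z)" using Re_U by blast
  \<comment> \<open>The first entry serves the points near \<open>1\<close>; the second is the lower
    bound \<open>k * \<delta>\<^sup>2 / 2\<close> for the others, divided by the bound
    \<open>2\<close> for the root.\<close>
  define m where "m = min (sqrt \<gamma>) (k * \<delta>\<^sup>2 / 4)"
  have "m * sqrt (norm (1 - z)) \<le> norm (U z)" if z: "norm z < 1" for z
  proof (cases "norm (1 - z) < \<delta>")
    case True
    have "norm (U z ^ 2 - of_real (2 * \<gamma>) * (1 - z)) \<le> 2 * (\<gamma> / 2) / 1 * norm (1 - z) powr 1"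
    proof (rule U_square_expansion[OF z])
      fix p :: complex assume p: "norm p < 1" "norm (1 - p) \<le> norm (1 - z)"
      then have "1 - p \<noteq> 0" by auto
      then show "norm (R p - R 1) \<le> \<gamma> / 2 * norm (1 - p) powr (1 - 1)"
        using \<delta>(2)[of p] p True by (simp add: dist_norm norm_minus_commute)
    qed simp
    moreover have "norm (of_real (2 * \<gamma>) * (1 - z)) = 2 * \<gamma> * norm (1 - z)"
      using \<gamma>_pos unfolding norm_mult norm_of_real by simp
    ultimately have "\<gamma> * norm (1 - z) \<le> norm (U z ^ 2)"
      using norm_triangle_ineq2[of "of_real (2 * \<gamma>) * (1 - z)" "U z ^ 2"]
      by (simp add: norm_minus_commute)
    then have "sqrt (\<gamma> * norm (1 - z)) \<le> norm (U z)"
      by (intro real_le_lsqrt) (simp_all add: norm_power)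
    moreover have "m * sqrt (norm (1 - z)) \<le> sqrt \<gamma> * sqrt (norm (1 - z))"
      unfolding m_def by (intro mult_right_mono) auto
    ultimately show ?thesis by (simp add: real_sqrt_mult)
  next
    case False
    have N: "norm (1 - z) < 2" using norm_one_minus_lt_2[OF z] by blast
    then have s: "sqrt (norm (1 - z)) \<le> 2" by (intro real_le_lsqrt) auto
    have "(norm (1 - z))\<^sup>2 = 1 - 2 * Re z + (norm z)\<^sup>2"
      unfolding cmod_power2 by (simp add: power2_eq_square algebra_simps)
    also have "\<dots> \<le> 2 * (1 - Re z)" using z by (simp add: power_le_one)
    finally have "\<delta>\<^sup>2 \<le> 2 * (1 - Re z)"
      using False \<delta>(1) power_mono[of \<delta> "norm (1 - z)" 2] by linarith
    then have "k * (\<delta>\<^sup>2 / 2) \<le> k * (1 - Re z)" using k(1) by (intro mult_left_mono) auto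
    also have "\<dots> \<le> norm (U z)" using k(2)[of z] z complex_Re_le_cmod[of "U z"] by linarith
    finally have 1: "k * (\<delta>\<^sup>2 / 2) \<le> norm (U z)" .
    have "m * sqrt (norm (1 - z)) \<le> (k * \<delta>\<^sup>2 / 4) * 2"
      using s k \<delta> by (intro mult_mono) (auto simp: m_def)
    then show ?thesis using 1 by simp
  qed
  moreover have "m > 0" unfolding m_def using \<gamma>_pos k \<delta> by simp
  ultimately show ?thesis using that by blast
qed

lemma U_nonzero: "norm z < 1 \<Longrightarrow> U z \<noteq> 0"
  by (metis norm_U_lower norm_one_minus_lt_2 mult_pos_pos norm_zero not_le real_sqrt_gt_zero)

lemma F'_eq: "norm z < 1 \<Longrightarrow> F' z = A z / U z"
  using A_eq U_nonzero by (simp add: field_simps)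

lemma tame_F: "tame F"
proof -
  obtain m where m: "m > 0" "\<And>z. norm z < 1 \<Longrightarrow> m * sqrt (norm (1 - z)) \<le> norm (U z)"
    using norm_U_lower by blast
  have "continuous_on (cball 0 1) A" unfolding A_def by (intro continuous_intros continuous_F)
  then have "bounded (A ` cball 0 1)" by (intro compact_imp_bounded compact_continuous_image) auto
  then obtain M where M: "\<forall>y\<in>A ` cball 0 1. norm y \<le> M" unfolding bounded_iff by blast
  show ?thesis
  proof (rule tameI[where h' = F' and K = "M / m"])
    fix z :: complex assume z: "norm z < 1"
    show "(F has_field_derivative F' z) (at z)" using z by (rule has_derivative_F)
    have "norm (F' z) = norm (A z) / norm (U z)" by (simp add: F'_eq[OF z] norm_divide)
    also have "\<dots> \<le> M / (m * sqrt (norm (1 - z)))"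
    proof (rule frac_le)
      show AM: "norm (A z) \<le> M" using M z by simp
      show "0 \<le> M" using AM norm_ge_zero order.trans by blast
    qed (use m z norm_one_minus_lt_2[OF z] in auto)
    finally show "norm (F' z) \<le> M / m / sqrt (norm (1 - z))" by simp
  qed (rule continuous_F)
qed

lemma tame_A: "tame A" and tame_C: "tame C" and tame_H: "tame H" and tame_U: "tame U" and tame_R: "tame R"
proof -
  show A: "tame A" unfolding A_def
    by (intro tame_sum tame_mult tame_power tame_const tame_ident tame_F)
  show C: "tame C" unfolding C_def
    by (intro tame_sum tame_mult tame_power tame_const tame_ident tame_F)
  show H: "tame H" unfolding H_def
    by (intro tame_sum tame_mult tame_power tame_const tame_ident tame_F)
  show U: "tame U" unfolding U_def
    by (intro tame_diff tame_sum tame_mult tame_power tame_const tame_ident tame_F)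
  show "tame R" unfolding R_def by (intro tame_add tame_mult A C H U)
qed

end

section \<open>The principal inverse square root and its coefficients\<close>

lemma csqrt_one_minus:
  fixes z :: complex
  assumes "norm z < 1"
  shows "norm (csqrt (1 - z)) = sqrt (norm (1 - z))" "csqrt (1 - z) \<noteq> 0"
    "norm (csqrt (1 - z)) / 2 \<le> Re (csqrt (1 - z))"
proof -
  define s where "s = csqrt (1 - z)"
  have s2: "s\<^sup>2 = 1 - z" and re: "Re s \<ge> 0" and norm_s: "norm s = sqrt (norm (1 - z))"
    by (simp_all add: s_def Re_csqrt del: csqrt.simps)
  \<comment> \<open>The disc lies to the left of \<open>1\<close>, so \<open>1 - z\<close> is in the
    right half-plane and its root has an argument below \<open>pi / 4\<close> in absolute value: the
    real part dominates.\<close>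
  have "Re (s\<^sup>2) > 0" using assms complex_Re_le_cmod[of z] unfolding s2 by simp
  then have "(Im s)\<^sup>2 < (Re s)\<^sup>2" by (simp add: power2_eq_square)
  moreover have "(2 * Re s)\<^sup>2 = 4 * (Re s)\<^sup>2" by (simp add: power_mult_distrib)
  ultimately have "(norm s)\<^sup>2 \<le> (2 * Re s)\<^sup>2"
    unfolding cmod_power2 using zero_le_power2[of "Re s"] by linarith
  then have "norm s \<le> 2 * Re s" by (rule power2_le_imp_le) (use re in simp)
  then have "norm s / 2 \<le> Re s" by simp
  moreover have "s \<noteq> 0" using \<open>Re (s\<^sup>2) > 0\<close> by (auto simp del: Re_power2)
  ultimately show "norm (csqrt (1 - z)) = sqrt (norm (1 - z))" "csqrt (1 - z) \<noteq> 0"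
    "norm (csqrt (1 - z)) / 2 \<le> Re (csqrt (1 - z))"
    using norm_s unfolding s_def by blast+
qed

lemma gbinomial_of_real: "(of_real x :: complex) gchoose k = of_real (x gchoose k)"
  by (simp add: gbinomial_prod_rev of_real_prod)

lemma inverse_csqrt_sums:
  fixes z :: complex
  assumes "norm z < 1"
  shows "(\<lambda>k. of_real (((- 1/2) gchoose k) * (- 1) ^ k) * z ^ k) sums (1 / csqrt (1 - z))"
proof -
  have "(\<lambda>k. ((- 1/2) gchoose k) * (- z) ^ k) sums (1 + - z) powr (- 1/2)"
    by (rule gen_binomial_complex) (use assms in simp)
  moreover have "(1 + - z) powr (- 1/2) = 1 / csqrt (1 - z)"
  proof -
    have "(1 + - z) powr (- 1/2) = (1 - z) powr (- (1/2))" by simp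
    also have "\<dots> = inverse ((1 - z) powr (1/2))" by (rule powr_minus)
    finally show ?thesis unfolding csqrt_conv_powr inverse_eq_divide .
  qed
  moreover have "of_real ((- 1/2) gchoose k) = ((- 1/2 :: complex) gchoose k)" for k
    using gbinomial_of_real[of "- 1/2" k] by simp
  ultimately show ?thesis
    by (simp only: of_real_mult of_real_power of_real_minus of_real_1 mult.assoc flip: power_mult_distrib) simp
qed

lemma cube_cancel:
  fixes w :: real
  assumes "w > 0"
  shows "x * w ^ 3 / ((m * w) * (k * w) * (l * w)) = x / (m * k * l)"
proof -
  have "(m * w) * (k * w) * (l * w) = m * k * l * w ^ 3" by (simp add: power3_eq_cube)
  then show ?thesis using assms mult_divide_mult_cancel_right[of "w ^ 3" x "m * k * l"] by (metis less_irrefl zero_less_power)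
qed

text \<open>With \<open>w\<close> the root of \<open>|1 - z|\<close>, every term of the bound in
  \<open>singular_part\<close> is homogeneous of degree \<open>-2\<close> in
  \<open>w\<close>.\<close>

lemma common_denominator:
  fixes w :: real
  assumes "w \<noteq> 0"
  shows "a / w * (1 / (m * w)) + b * (1 / (m * w)) ^ 2 + (d * w) * (1 / (m * w)) ^ 3 +
      p * (e * ((1 / (m * w)) ^ 2 + 1 / (m * w) * (1 / (k * w)) + (1 / (k * w)) ^ 2)) =
    (a / m + b / m ^ 2 + d / m ^ 3 + p * (e * (1 / m ^ 2 + 1 / (m * k) + 1 / k ^ 2))) / w ^ 2"
proof -
  define v i j where "v = inverse w" and "i = inverse m" and "j = inverse k"
  have "w * v = 1" using assms by (simp add: v_def)
  then have "(a * v) * (i * v) + b * (i * v) ^ 2 + (d * w) * (i * v) ^ 3 +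
      p * (e * ((i * v) ^ 2 + (i * v) * (j * v) + (j * v) ^ 2)) =
    (a * i + b * i ^ 2 + d * i ^ 3 + p * (e * (i ^ 2 + i * j + j ^ 2))) * v ^ 2"
    by algebra
  then show ?thesis
    by (simp only: v_def i_def j_def divide_inverse inverse_mult_distrib power_inverse mult_1_left)
qed

text \<open>The limit is \<open>1 / Gamma (1/2)\<close>, from the asymptotics of generalised
  binomial coefficients.\<close>

lemma inverse_sqrt_coeff_asymp:
  "(\<lambda>k. ((- 1/2 :: real) gchoose k) * (- 1) ^ k * real k powr (1/2)) \<longlonglongrightarrow> 1 / sqrt pi"
proof -
  have lim: "(\<lambda>k. ((- 1/2 :: real) gchoose k) / ((- 1) ^ k / exp ((- 1/2 + 1) * of_real (ln (real k)))))
      \<longlonglongrightarrow> inverse (Gamma (- (- 1/2)))"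
    by (rule gbinomial_asymptotic)
  have Gamma: "inverse (Gamma (- (- 1/2) :: real)) = 1 / sqrt pi"
    by (simp only: minus_divide_left minus_minus Gamma_one_half_real inverse_eq_divide)
  have "\<forall>\<^sub>F k in sequentially.
      ((- 1/2 :: real) gchoose k) / ((- 1) ^ k / exp ((- 1/2 + 1) * of_real (ln (real k)))) =
      ((- 1/2 :: real) gchoose k) * (- 1) ^ k * real k powr (1/2)"
    using eventually_gt_at_top[of 0]
  proof eventually_elim
    case (elim k)
    have div: "x / ((- 1) ^ k / y) = x * (- 1) ^ k * y" for x y :: real
      by (cases "even k") simp_all
    have "exp ((- 1/2 + 1) * of_real (ln (real k))) = real k powr (1/2)"
      using elim by (simp add: powr_def)
    then show ?case by (simp only: div)
  qed
  from tendsto_cong[OF this] show ?thesis using lim unfolding Gamma by blast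
qed

section \<open>Comparison of \<open>F'\<close> with the inverse square root\<close>

context critical_system
begin

definition \<kappa> :: real where "\<kappa> = sqrt (2 * \<gamma>)"

lemma \<kappa>_pos: "\<kappa> > 0"
  unfolding \<kappa>_def using \<gamma>_pos by simp

text \<open>With \<open>s\<close> the root, the difference is \<open>(\<kappa>\<^sup>2 s\<^sup>2 -
  U\<^sup>2) / (U * \<kappa> s * (\<kappa> s + U))\<close>. The numerator is of third order in
  \<open>|s|\<close>, and each of the three factors below is at least of first order.\<close>

lemma inverse_U_near_inverse_csqrt:
  obtains K where "K \<ge> 0" "\<And>z. norm z < 1 \<Longrightarrow> norm (1 / U z - 1 / (of_real \<kappa> * csqrt (1 - z))) \<le> K"
proof -
  obtain m where m: "m > 0" "\<And>z. norm z < 1 \<Longrightarrow> m * sqrt (norm (1 - z)) \<le> norm (U z)"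
    using norm_U_lower by blast
  obtain L where L: "L \<ge> 0" "\<And>z. norm z < 1 \<Longrightarrow> norm (R z - R 1) \<le> L * sqrt (norm (1 - z))"
    using tame_diff_at_1[OF tame_R] by blast
  obtain k where k: "k > 0" "\<And>z. norm z \<le> 1 \<Longrightarrow> Re (U z) \<ge> k * (1 - Re z)" using Re_U by blast
  define K where "K = (2 * L / (3/2)) / (m * \<kappa> * (\<kappa> / 2))"
  have "norm (1 / U z - 1 / (of_real \<kappa> * csqrt (1 - z))) \<le> K" if z: "norm z < 1" for z
  proof -
    define s where "s = csqrt (1 - z)"
    define w where "w = sqrt (norm (1 - z))"
    have w: "w > 0" "w ^ 2 = norm (1 - z)" using norm_one_minus_lt_2[OF z] by (auto simp: w_def)
    have s: "norm s = w" "s \<noteq> 0" "w / 2 \<le> Re s" "s ^ 2 = 1 - z"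
      using csqrt_one_minus[OF z] by (simp_all add: s_def w_def)
    have "norm (U z ^ 2 - of_real (2 * \<gamma>) * (1 - z)) \<le> 2 * L / (3/2) * norm (1 - z) powr (3/2)"
      by (rule U_square_expansion[OF z]) (use L(2) in \<open>auto simp: powr_half_sqrt\<close>)
    also have "norm (1 - z) powr (3/2) = norm (1 - z) powr (1 + 1/2)" by simp
    also have "\<dots> = w ^ 3"
      unfolding powr_add powr_half_sqrt[OF norm_ge_zero] w_def[symmetric]
      using w by (simp add: power3_eq_cube power2_eq_square flip: w(2))
    also have "of_real (2 * \<gamma>) * (1 - z) = (of_real \<kappa> * s) ^ 2"
      using \<gamma>_pos by (simp add: power_mult_distrib s(4) \<kappa>_def flip: of_real_power)
    finally have num: "norm ((of_real \<kappa> * s) ^ 2 - U z ^ 2) \<le> 2 * L / (3/2) * w ^ 3"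
      by (simp add: norm_minus_commute)
    \<comment> \<open>This selects the branch: \<open>U z\<close> and \<open>s\<close> both have
      nonnegative real part, so \<open>of_real \<kappa> * s + U z\<close> has no cancellation and
      \<open>U z\<close> is near the principal root, not its negative.\<close>
    have "1 - Re z \<ge> 0" using complex_Re_le_cmod[of z] z by simp
    then have "Re (U z) \<ge> 0" using k(2)[of z] k(1) z by (meson less_imp_le mult_nonneg_nonneg order_trans)
    moreover have "\<kappa> * (w / 2) \<le> \<kappa> * Re s" using s(3) \<kappa>_pos by (intro mult_left_mono) auto
    ultimately have "\<kappa> * (w / 2) \<le> Re (of_real \<kappa> * s + U z)" by simp
    also have "\<dots> \<le> norm (of_real \<kappa> * s + U z)" by (rule complex_Re_le_cmod)
    finally have sum: "\<kappa> / 2 * w \<le> norm (of_real \<kappa> * s + U z)" by simp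
    have "0 < \<kappa> / 2 * w" using w(1) \<kappa>_pos by simp
    with sum have "0 < norm (of_real \<kappa> * s + U z)" by linarith
    then have "of_real \<kappa> * s + U z \<noteq> 0" by (simp only: zero_less_norm_iff not_False_eq_True)
    then have eq: "1 / U z - 1 / (of_real \<kappa> * s) =
        ((of_real \<kappa> * s) ^ 2 - U z ^ 2) / (U z * (of_real \<kappa> * s) * (of_real \<kappa> * s + U z))"
      using U_nonzero[OF z] s(2) \<kappa>_pos by (simp add: divide_simps) algebra
    have "norm (((of_real \<kappa> * s) ^ 2 - U z ^ 2) / (U z * (of_real \<kappa> * s) * (of_real \<kappa> * s + U z)))
        \<le> (2 * L / (3/2) * w ^ 3) / ((m * w) * (\<kappa> * w) * (\<kappa> / 2 * w))"
      unfolding norm_divide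
    proof (rule frac_le[OF _ num])
      show "0 \<le> 2 * L / (3/2) * w ^ 3" using L(1) w(1) by simp
      show "0 < (m * w) * (\<kappa> * w) * (\<kappa> / 2 * w)" using m(1) w(1) \<kappa>_pos by simp
      have "m * w \<le> norm (U z)" unfolding w_def by (rule m(2)[OF z])
      moreover have "norm (of_real \<kappa> * s) = \<kappa> * w" using \<kappa>_pos by (simp add: norm_mult s(1))
      moreover have "0 \<le> \<kappa> * w" "0 \<le> \<kappa> / 2 * w" using w(1) \<kappa>_pos by simp_all
      ultimately show "(m * w) * (\<kappa> * w) * (\<kappa> / 2 * w) \<le>
          norm (U z * (of_real \<kappa> * s) * (of_real \<kappa> * s + U z))"
        unfolding norm_mult[of _ "of_real \<kappa> * s + U z"] norm_mult[of "U z"]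
        by (intro mult_mono[OF _ sum] mult_mono) simp_all
    qed
    also have "\<dots> = K"
      unfolding K_def by (rule cube_cancel) (rule w(1))
    finally show ?thesis unfolding s_def[symmetric] eq .
  qed
  moreover have "K \<ge> 0" unfolding K_def using L m \<kappa>_pos by simp
  ultimately show ?thesis using that by blast
qed

lemma has_derivative_F':
  assumes z: "norm z < 1" and A': "(A has_field_derivative A') (at z)"
  shows "(F' has_field_derivative A' / U z + A z * C z / U z ^ 2 + A z ^ 2 * H z / U z ^ 3) (at z)"
proof -
  have "((\<lambda>z. A z / U z) has_field_derivative
      (A' * U z - A z * - (C z + H z * F' z)) / (U z * U z)) (at z)"
    by (rule DERIV_divide[OF A' has_derivative_U[OF z] U_nonzero[OF z]])
  also have "(A' * U z - A z * - (C z + H z * F' z)) / (U z * U z) =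
      A' / U z + A z * C z / U z ^ 2 + A z ^ 2 * H z / U z ^ 3"
    using U_nonzero[OF z] unfolding F'_eq[OF z]
    by (simp add: divide_simps power2_eq_square power3_eq_cube) (simp add: algebra_simps)
  finally show ?thesis
    by (rule has_field_derivative_transform_within_open[where S = "ball 0 1"])
      (use z F'_eq in auto)
qed

text \<open>In the derivative of \<open>A / U\<close> only the term with \<open>U\<^sup>3\<close> in
  the denominator exceeds the order \<open>1 / |1 - z|\<close>. The subtracted inverse root has
  derivative \<open>P 1 / (\<kappa> s)\<^sup>3\<close>, which cancels its leading part.\<close>

lemma singular_part:
  "\<exists>h' K. K \<ge> 0 \<and> (\<forall>z. norm z < 1 \<longrightarrow>
    ((\<lambda>z. F' z - of_real (A\<^sub>1 / \<kappa>) * (1 / csqrt (1 - z))) has_field_derivative h' z) (at z) \<and>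
    norm (h' z) \<le> K / norm (1 - z))"
proof -
  obtain m where m: "m > 0" "\<And>z. norm z < 1 \<Longrightarrow> m * sqrt (norm (1 - z)) \<le> norm (U z)"
    using norm_U_lower by blast
  obtain K\<^sub>U where KU: "K\<^sub>U \<ge> 0"
    "\<And>z. norm z < 1 \<Longrightarrow> norm (1 / U z - 1 / (of_real \<kappa> * csqrt (1 - z))) \<le> K\<^sub>U"
    using inverse_U_near_inverse_csqrt by blast
  obtain K\<^sub>A A' where A': "K\<^sub>A \<ge> 0" "\<And>z. norm z < 1 \<Longrightarrow> (A has_field_derivative A' z) (at z)"
    "\<And>z. norm z < 1 \<Longrightarrow> norm (A' z) \<le> K\<^sub>A / sqrt (norm (1 - z))"
    using tameE[OF tame_A] by blast
  obtain M where M: "M \<ge> 0" "\<And>z. norm z \<le> 1 \<Longrightarrow> norm (A z * C z) \<le> M"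
    using tame_bounded[OF tame_mult[OF tame_A tame_C]] by blast
  define P where "P = (\<lambda>z. A z ^ 2 * H z)"
  have "tame P" unfolding P_def by (intro tame_mult tame_power tame_A tame_H)
  then obtain K\<^sub>P where KP: "K\<^sub>P \<ge> 0" "\<And>z. norm z < 1 \<Longrightarrow> norm (P z - P 1) \<le> K\<^sub>P * sqrt (norm (1 - z))"
    using tame_diff_at_1 by blast
  define h' where "h' = (\<lambda>z. (A' z / U z + A z * C z / U z ^ 2 + P z / U z ^ 3) -
    P 1 / (of_real \<kappa> * csqrt (1 - z)) ^ 3)"
  define K where "K = K\<^sub>A / m + M / m ^ 2 + K\<^sub>P / m ^ 3 +
    norm (P 1) * (K\<^sub>U * (1 / m ^ 2 + 1 / (m * \<kappa>) + 1 / \<kappa> ^ 2))"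
  \<comment> \<open>\<open>P 1\<close> is \<open>A\<^sub>1\<^sup>2 H\<^sub>1\<close> and
    \<open>\<kappa>\<^sup>2\<close> is \<open>2 H\<^sub>1 A\<^sub>1\<close>; this equality is why
    \<open>A\<^sub>1 / \<kappa>\<close> is the right factor of the inverse root.\<close>
  have P1: "P 1 = of_real (A\<^sub>1 * \<kappa>\<^sup>2 / 2)"
    using \<gamma>_pos by (simp add: P_def A_1 H_1 \<kappa>_def \<gamma>_def power2_eq_square mult_ac)
  show ?thesis
  proof (intro exI[of _ h'] exI[of _ K] conjI allI impI)
    show "K \<ge> 0" unfolding K_def using A'(1) M(1) KP(1) KU(1) m(1) \<kappa>_pos by simp
  next
    fix z :: complex assume z: "norm z < 1"
    define s where "s = csqrt (1 - z)"
    have s: "s \<noteq> 0" "s ^ 2 = 1 - z" using csqrt_one_minus(2)[OF z] by (simp_all add: s_def)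
    have "1 - z \<notin> \<real>\<^sub>\<le>\<^sub>0"
      using z complex_Re_le_cmod[of z] by (auto simp: complex_nonpos_Reals_iff)
    then have "((\<lambda>z. csqrt (1 - z)) has_field_derivative (0 - 1) / (2 * s)) (at z)"
      unfolding s_def by (auto intro!: derivative_eq_intros)
    then have "((\<lambda>z. 1 / csqrt (1 - z)) has_field_derivative
        (0 * s - 1 * ((0 - 1) / (2 * s))) / (s * s)) (at z)"
      unfolding s_def using s(1) by (intro DERIV_divide DERIV_const) (auto simp: s_def)
    then have "((\<lambda>z. of_real (A\<^sub>1 / \<kappa>) * (1 / csqrt (1 - z))) has_field_derivative
        of_real (A\<^sub>1 / \<kappa>) * ((0 * s - 1 * ((0 - 1) / (2 * s))) / (s * s))) (at z)"
      by (rule DERIV_cmult)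
    also have "of_real (A\<^sub>1 / \<kappa>) * ((0 * s - 1 * ((0 - 1) / (2 * s))) / (s * s)) = P 1 / (of_real \<kappa> * s) ^ 3"
      unfolding P1 using s \<kappa>_pos by (simp add: field_simps power3_eq_cube power2_eq_square)
    finally show "((\<lambda>z. F' z - of_real (A\<^sub>1 / \<kappa>) * (1 / csqrt (1 - z))) has_field_derivative h' z) (at z)"
      unfolding h'_def s_def P_def by (intro DERIV_diff has_derivative_F' z A')
  next
    fix z :: complex assume z: "norm z < 1"
    define w where "w = sqrt (norm (1 - z))"
    have w: "w > 0" "norm (1 - z) = w ^ 2" using norm_one_minus_lt_2[OF z] by (auto simp: w_def)
    define u where "u = 1 / U z"
    define v where "v = 1 / (of_real \<kappa> * csqrt (1 - z))"
    have u: "norm u \<le> 1 / (m * w)"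
      unfolding u_def norm_divide using m(2)[OF z] m(1) w(1) by (intro frac_le) (auto simp: w_def)
    have v: "norm v = 1 / (\<kappa> * w)"
      unfolding v_def norm_divide norm_mult using csqrt_one_minus(1)[OF z] \<kappa>_pos by (simp add: w_def)
    have uv: "norm (u - v) \<le> K\<^sub>U" unfolding u_def v_def by (rule KU(2)[OF z])
    \<comment> \<open>The difference \<open>P z * u ^ 3 - P 1 * v ^ 3\<close> is split into a change
      of \<open>P\<close> and a change of \<open>u ^ 3\<close>. Each gains one factor
      \<open>w\<close>: the first because \<open>P\<close> is tame, the second because
      \<open>u - v\<close> is bounded.\<close>
    have eq: "h' z = A' z * u + A z * C z * u ^ 2 + (P z - P 1) * u ^ 3 +
        P 1 * ((u - v) * (u ^ 2 + u * v + v ^ 2))"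
    proof -
      have "h' z = A' z * u + A z * C z * u ^ 2 + P z * u ^ 3 - P 1 * v ^ 3"
        by (simp add: h'_def u_def v_def power_divide)
      then show ?thesis by (simp add: algebra_simps power2_eq_square power3_eq_cube)
    qed
    have n1: "norm (A' z * u) \<le> K\<^sub>A / w * (1 / (m * w))"
      unfolding norm_mult using A'(1,3) z u w(1) by (intro mult_mono) (auto simp: w_def)
    have n2: "norm (A z * C z * u ^ 2) \<le> M * (1 / (m * w)) ^ 2"
      unfolding norm_mult[of "A z * C z"] norm_power using M z u by (intro mult_mono power_mono) auto
    have n3: "norm ((P z - P 1) * u ^ 3) \<le> (K\<^sub>P * w) * (1 / (m * w)) ^ 3"
      unfolding norm_mult norm_power using KP z u w(1) by (intro mult_mono power_mono) (auto simp: w_def)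
    have n4: "norm (P 1 * ((u - v) * (u ^ 2 + u * v + v ^ 2))) \<le>
        norm (P 1) * (K\<^sub>U * ((1 / (m * w)) ^ 2 + 1 / (m * w) * (1 / (\<kappa> * w)) + (1 / (\<kappa> * w)) ^ 2))"
    proof -
      have "norm (u ^ 2 + u * v + v ^ 2) \<le> norm u ^ 2 + norm u * norm v + norm v ^ 2"
        by (intro order.trans[OF norm_triangle_ineq] add_mono) (simp_all add: norm_mult norm_power)
      also have "\<dots> \<le> (1 / (m * w)) ^ 2 + 1 / (m * w) * (1 / (\<kappa> * w)) + (1 / (\<kappa> * w)) ^ 2"
        unfolding v using u m(1) \<kappa>_pos w(1) by (intro add_mono mult_mono power_mono) auto
      finally show ?thesis
        unfolding norm_mult using uv KU(1) by (intro mult_left_mono mult_mono) auto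
    qed
    have "norm (h' z) \<le> K\<^sub>A / w * (1 / (m * w)) + M * (1 / (m * w)) ^ 2 + (K\<^sub>P * w) * (1 / (m * w)) ^ 3 +
        norm (P 1) * (K\<^sub>U * ((1 / (m * w)) ^ 2 + 1 / (m * w) * (1 / (\<kappa> * w)) + (1 / (\<kappa> * w)) ^ 2))"
      unfolding eq by (intro norm_triangle_mono n1 n2 n3 n4)
    also have "\<dots> = K / w ^ 2"
      unfolding K_def by (rule common_denominator) (use w(1) in simp)
    finally show "norm (h' z) \<le> K / norm (1 - z)" by (simp add: w(2))
  qed
qed

text \<open>The coefficients \<open>(k + 1) * a (k + 1)\<close> of \<open>F'\<close> are
  \<open>q\<close> times those of the inverse root plus \<open>d k\<close>, so the limit is
  \<open>q / sqrt pi\<close>.\<close>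

theorem coeff_asymp:
  obtains L where "L > 0" "(\<lambda>k. a k * real k powr (3/2)) \<longlonglongrightarrow> L"
proof -
  obtain h' K where "K \<ge> 0" and h': "\<forall>z. norm z < 1 \<longrightarrow>
      ((\<lambda>z. F' z - of_real (A\<^sub>1 / \<kappa>) * (1 / csqrt (1 - z))) has_field_derivative h' z) (at z) \<and>
      norm (h' z) \<le> K / norm (1 - z)"
    using singular_part by (elim exE conjE)
  define b where "b = (\<lambda>k. ((- 1/2 :: real) gchoose k) * (- 1) ^ k)"
  define q where "q = A\<^sub>1 / \<kappa>"
  define d where "d = (\<lambda>k. real (Suc k) * a (Suc k) - q * b k)"
  have sums: "(\<lambda>k. of_real (d k) * z ^ k) sums (F' z - of_real (A\<^sub>1 / \<kappa>) * (1 / csqrt (1 - z)))"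
    if "norm z < 1" for z :: complex
  proof -
    have "(\<lambda>k. diffs (\<lambda>k. of_real (a k)) k * z ^ k - of_real q * (of_real (b k) * z ^ k)) sums
        (F' z - of_real q * (1 / csqrt (1 - z)))"
      unfolding b_def by (intro sums_diff sums_mult F'_sums inverse_csqrt_sums that)
    then show ?thesis by (simp add: d_def diffs_def q_def algebra_simps)
  qed
  have d_bound: "\<bar>d (Suc k)\<bar> \<le> 12 * K * ln (real k + 3) / real (Suc k)" for k
  proof -
    have "norm (complex_of_real (d (Suc k))) \<le> 12 * K * ln (real k + 3) / real (Suc k)"
      by (rule coeff_bound_log[where h' = h', OF sums]) (use h' \<open>K \<ge> 0\<close> in simp_all)
    then show ?thesis by simp
  qed
  \<comment> \<open>The error bound starts at index \<open>1\<close> and \<open>F'\<close> is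
    already shifted by one, so \<open>a\<close> is read at \<open>k + 2\<close>. Even after
    multiplication by the root, an error of order \<open>ln k / k\<close> vanishes.\<close>
  have "(\<lambda>k. d (Suc k) * (real k + 2) powr (1/2)) \<longlonglongrightarrow> 0"
  proof (rule Lim_null_comparison)
    show "\<forall>\<^sub>F k in sequentially. norm (d (Suc k) * (real k + 2) powr (1/2)) \<le>
        12 * K * ln (real k + 3) / real (Suc k) * (real k + 2) powr (1/2)"
    proof (intro always_eventually allI)
      fix k
      have "norm (d (Suc k) * (real k + 2) powr (1/2)) = \<bar>d (Suc k)\<bar> * (real k + 2) powr (1/2)"
        by (simp add: abs_mult)
      also have "\<dots> \<le> 12 * K * ln (real k + 3) / real (Suc k) * (real k + 2) powr (1/2)"
        by (rule mult_right_mono[OF d_bound]) simp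
      finally show "norm (d (Suc k) * (real k + 2) powr (1/2)) \<le>
        12 * K * ln (real k + 3) / real (Suc k) * (real k + 2) powr (1/2)" .
    qed
    show "(\<lambda>k. 12 * K * ln (real k + 3) / real (Suc k) * (real k + 2) powr (1/2)) \<longlonglongrightarrow> 0"
      by real_asymp
  qed
  moreover have "(\<lambda>k. q * (b (Suc k) * real (Suc k) powr (1/2)) * ((real k + 2) powr (1/2) / real (Suc k) powr (1/2)))
      \<longlonglongrightarrow> q * (1 / sqrt pi) * 1"
  proof (intro tendsto_intros)
    show "(\<lambda>k. b (Suc k) * real (Suc k) powr (1/2)) \<longlonglongrightarrow> 1 / sqrt pi"
      using filterlim_sequentially_Suc[of "\<lambda>k. b k * real k powr (1/2)" "nhds (1 / sqrt pi)"]
        inverse_sqrt_coeff_asymp unfolding b_def by blast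
    show "(\<lambda>k. (real k + 2) powr (1/2) / real (Suc k) powr (1/2)) \<longlonglongrightarrow> 1"
      by real_asymp
  qed
  ultimately have "(\<lambda>k. d (Suc k) * (real k + 2) powr (1/2) +
      q * (b (Suc k) * real (Suc k) powr (1/2)) * ((real k + 2) powr (1/2) / real (Suc k) powr (1/2)))
      \<longlonglongrightarrow> 0 + q * (1 / sqrt pi) * 1"
    by (rule tendsto_add)
  also have "(\<lambda>k. d (Suc k) * (real k + 2) powr (1/2) +
      q * (b (Suc k) * real (Suc k) powr (1/2)) * ((real k + 2) powr (1/2) / real (Suc k) powr (1/2))) =
      (\<lambda>k. a (k + 2) * real (k + 2) powr (3/2))"
  proof
    fix k
    have "(real k + 2) powr (3/2) = (real k + 2) powr (1 + 1/2)" by simp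
    also have "\<dots> = (real k + 2) * (real k + 2) powr (1/2)" by (subst powr_add) simp
    finally have p: "(real k + 2) powr (3/2) = (real k + 2) * (real k + 2) powr (1/2)" .
    have "real (Suc k) powr (1/2) \<noteq> 0" by simp
    then have "d (Suc k) * (real k + 2) powr (1/2) +
      q * (b (Suc k) * real (Suc k) powr (1/2)) * ((real k + 2) powr (1/2) / real (Suc k) powr (1/2)) =
      (d (Suc k) + q * b (Suc k)) * (real k + 2) powr (1/2)"
      by (simp add: field_simps del: of_nat_Suc)
    also have "d (Suc k) + q * b (Suc k) = (real k + 2) * a (k + 2)"
      by (simp add: d_def algebra_simps)
    finally show "d (Suc k) * (real k + 2) powr (1/2) +
      q * (b (Suc k) * real (Suc k) powr (1/2)) * ((real k + 2) powr (1/2) / real (Suc k) powr (1/2)) =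
      a (k + 2) * real (k + 2) powr (3/2)"
      using p by (simp add: add.commute mult_ac)
  qed
  finally have "(\<lambda>k. a k * real k powr (3/2)) \<longlonglongrightarrow> q / sqrt pi"
    by (simp add: LIMSEQ_offset[where k = 2] del: of_nat_add)
  moreover have "q / sqrt pi > 0" unfolding q_def using A\<^sub>1_pos \<kappa>_pos by simp
  ultimately show ?thesis using that by blast
qed

end

section \<open>The critical point of a polynomial fixed-point equation\<close>

text \<open>Partial sums are polynomials, hence finite and continuous at every \<open>x\<close>
  before anything is known about convergence.\<close>

definition psum :: "real fps \<Rightarrow> nat \<Rightarrow> real \<Rightarrow> real" where
  "psum g N x = (\<Sum>k\<le>N. g $ k * x ^ k)"

definition nonneg :: "real fps \<Rightarrow> bool" where
  "nonneg g \<longleftrightarrow> (\<forall>k. g $ k \<ge> 0)"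

lemma nonneg_mult: "nonneg g \<Longrightarrow> nonneg h \<Longrightarrow> nonneg (g * h)"
  unfolding nonneg_def fps_mult_nth by (intro allI sum_nonneg mult_nonneg_nonneg) auto

lemma nonneg_power: "nonneg g \<Longrightarrow> nonneg (g ^ k)"
proof (induction k)
  case 0
  show ?case by (simp add: nonneg_def)
next
  case (Suc k)
  then show ?case by (simp add: nonneg_mult)
qed

lemma nonneg_X: "nonneg fps_X"
  by (simp add: nonneg_def fps_X_def)

lemma psum_nonneg: "nonneg g \<Longrightarrow> x \<ge> 0 \<Longrightarrow> psum g N x \<ge> 0"
  unfolding psum_def nonneg_def by (intro sum_nonneg) auto

text \<open>The product of the partial sums contains all index pairs of a square, the truncated
  product only those of the triangle \<open>i + j \<le> N\<close>.\<close>

lemma psum_mult_le: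
  assumes "nonneg g" "nonneg h" "x \<ge> 0"
  shows "psum (g * h) N x \<le> psum g N x * psum h N x"
proof -
  let ?t = "\<lambda>i j. (g $ i * x ^ i) * (h $ j * x ^ j)"
  have "psum (g * h) N x = (\<Sum>k\<le>N. \<Sum>i\<le>k. ?t i (k - i))"
    unfolding psum_def fps_mult_nth atLeast0AtMost sum_distrib_right
  proof (intro sum.cong refl)
    fix k i :: nat assume "i \<in> {..k}"
    then have "x ^ k = x ^ i * x ^ (k - i)" by (simp flip: power_add)
    then show "g $ i * h $ (k - i) * x ^ k = ?t i (k - i)" by simp
  qed
  also have "\<dots> = (\<Sum>(i, j)\<in>{(i, j). i + j \<le> N}. ?t i j)"
    by (rule sum.triangle_reindex_eq[symmetric])
  also have "\<dots> \<le> (\<Sum>(i, j)\<in>{..N} \<times> {..N}. ?t i j)"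
    using assms by (intro sum_mono2) (auto simp: nonneg_def)
  also have "\<dots> = psum g N x * psum h N x"
    unfolding psum_def sum_product sum.cartesian_product ..
  finally show ?thesis .
qed

lemma psum_power_le:
  assumes "nonneg g" "x \<ge> 0"
  shows "psum (g ^ k) N x \<le> psum g N x ^ k"
proof (induction k)
  case 0
  have "psum 1 N x = (\<Sum>k\<in>{0}. (1 :: real fps) $ k * x ^ k)"
    unfolding psum_def by (rule sum.mono_neutral_right) auto
  then show ?case by simp
next
  case (Suc k)
  have "psum (g * g ^ k) N x \<le> psum g N x * psum (g ^ k) N x"
    using assms by (intro psum_mult_le nonneg_power)
  also have "\<dots> \<le> psum g N x * psum g N x ^ k"
    using assms Suc by (intro mult_left_mono psum_nonneg) auto
  finally show ?case by simp
qed

text \<open>Only an inequality, since for \<open>N = 0\<close> the term of degree one is cut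
  off.\<close>

lemma psum_X_le: "x \<ge> 0 \<Longrightarrow> psum fps_X N x \<le> x"
proof -
  assume x: "x \<ge> 0"
  have "psum fps_X N x = (\<Sum>k\<in>{..N} \<inter> {1}. fps_X $ k * x ^ k)"
    unfolding psum_def by (rule sum.mono_neutral_right) (auto simp: fps_X_def)
  also have "\<dots> \<le> (\<Sum>k\<in>{1}. fps_X $ k * x ^ k)" using x by (intro sum_mono2) auto
  finally show ?thesis by simp
qed

section \<open>Evaluation of power series at points of absolute convergence\<close>

definition abs_conv :: "complex \<Rightarrow> real fps \<Rightarrow> bool" where
  "abs_conv z g \<longleftrightarrow> summable (\<lambda>k. norm (of_real (g $ k) * z ^ k))"

definition ev :: "complex \<Rightarrow> real fps \<Rightarrow> complex" where
  "ev z g = (\<Sum>k. of_real (g $ k) * z ^ k)"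

text \<open>Absolute convergence, not a radius of convergence, is the hypothesis because the
  equation is needed on the boundary circle too.\<close>

lemma ev_mult:
  assumes "abs_conv z g" "abs_conv z h"
  shows "abs_conv z (g * h)" "ev z (g * h) = ev z g * ev z h"
proof -
  let ?a = "\<lambda>k. of_real (g $ k) * z ^ k" and ?b = "\<lambda>k. of_real (h $ k) * z ^ k"
  have coeff: "of_real ((g * h) $ k) * z ^ k = (\<Sum>i\<le>k. ?a i * ?b (k - i))" for k
    unfolding fps_mult_nth atLeast0AtMost of_real_sum sum_distrib_right
  proof (intro sum.cong refl)
    fix k i :: nat assume "i \<in> {..k}"
    then have "z ^ k = z ^ i * z ^ (k - i)" by (simp flip: power_add)
    then show "of_real (g $ i * h $ (k - i)) * z ^ k = ?a i * ?b (k - i)" by simp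
  qed
  have "summable (\<lambda>k. \<Sum>i\<le>k. norm (?a i) * norm (?b (k - i)))"
    using assms unfolding abs_conv_def by (intro summable_Cauchy_product) simp_all
  then show "abs_conv z (g * h)"
    unfolding abs_conv_def coeff
    by (rule summable_comparison_test'[where N = 0]) (simp only: norm_mult[symmetric] real_norm_def abs_norm_cancel norm_sum)
  show "ev z (g * h) = ev z g * ev z h"
    using assms unfolding ev_def coeff abs_conv_def by (rule Cauchy_product[symmetric])
qed

lemma ev_power:
  assumes "abs_conv z g"
  shows "abs_conv z (g ^ k) \<and> ev z (g ^ k) = ev z g ^ k"
proof (induction k)
  case 0
  have "(\<lambda>k. norm (of_real ((1 :: real fps) $ k) * z ^ k)) sums
      (\<Sum>k\<in>{0}. norm (of_real ((1 :: real fps) $ k) * z ^ k))"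
    by (rule sums_finite) auto
  moreover have "(\<lambda>k. of_real ((1 :: real fps) $ k) * z ^ k) sums
      (\<Sum>k\<in>{0}. of_real ((1 :: real fps) $ k) * z ^ k)"
    by (rule sums_finite) auto
  ultimately show ?case by (simp add: abs_conv_def ev_def sums_iff)
qed (use assms ev_mult in auto)

lemma ev_X: "abs_conv z fps_X" "ev z fps_X = z"
proof -
  have "(\<lambda>k. norm (of_real (fps_X $ k) * z ^ k)) sums (\<Sum>k\<in>{1}. norm (of_real (fps_X $ k) * z ^ k))"
    by (rule sums_finite) (auto simp: fps_X_def)
  then show "abs_conv z fps_X" by (auto simp: abs_conv_def sums_iff)
  have "(\<lambda>k. of_real (fps_X $ k) * z ^ k) sums (\<Sum>k\<in>{1}. of_real (fps_X $ k) * z ^ k)"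
    by (rule sums_finite) (auto simp: fps_X_def)
  then show "ev z fps_X = z" by (auto simp: ev_def sums_iff)
qed

lemma ev_sum:
  assumes "\<And>e. e \<in> E \<Longrightarrow> abs_conv z (g e)"
  shows "ev z (\<Sum>e\<in>E. g e) = (\<Sum>e\<in>E. ev z (g e))"
proof -
  have "ev z (\<Sum>e\<in>E. g e) = (\<Sum>k. \<Sum>e\<in>E. of_real (g e $ k) * z ^ k)"
    by (simp add: ev_def fps_sum_nth sum_distrib_right)
  also have "\<dots> = (\<Sum>e\<in>E. ev z (g e))"
    unfolding ev_def using assms by (intro suminf_sum) (auto simp: abs_conv_def summable_norm_cancel)
  finally show ?thesis .
qed

text \<open>\<open>no_constant\<close> forbids the monomials \<open>1\<close> and \<open>w\<close>,
  so \<open>\<Phi> 0 w\<close> is \<open>O(w ^ 2)\<close> and small positive \<open>x\<close> are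
  subcritical. \<open>branching\<close> supplies a power \<open>w ^ j\<close> with
  \<open>j \<ge> 2\<close>, which bounds \<open>w\<close>; \<open>leaf\<close> supplies
  \<open>x\<close>, which then bounds \<open>x\<close> and makes \<open>\<tau>\<close> positive;
  \<open>unary\<close> supplies the \<open>x w\<close> behind \<open>linear\<close>.\<close>

locale monomial_system =
  fixes E :: "'e set" and \<alpha> \<beta> :: "'e \<Rightarrow> nat" and f :: "real fps"
  assumes finite_E: "finite E" and f_nonneg: "nonneg f" and f_0: "f $ 0 = 0"
    and f_eq: "f = (\<Sum>e\<in>E. fps_X ^ \<alpha> e * f ^ \<beta> e)"
    and no_constant: "\<And>e. e \<in> E \<Longrightarrow> \<alpha> e = 0 \<Longrightarrow> \<beta> e \<ge> 2"
    and leaf: "\<exists>e\<in>E. \<alpha> e = 1 \<and> \<beta> e = 0"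
    and unary: "\<exists>e\<in>E. \<alpha> e = 1 \<and> \<beta> e = 1"
    and branching: "\<exists>e\<in>E. \<alpha> e = 0"
begin

definition \<Phi> :: "real \<Rightarrow> real \<Rightarrow> real" where
  "\<Phi> x w = (\<Sum>e\<in>E. x ^ \<alpha> e * w ^ \<beta> e)"

definition subcritical :: "real set" where
  "subcritical = {x. x \<ge> 0 \<and> (\<exists>w\<ge>0. \<Phi> x w \<le> w)}"

definition \<rho> :: real where "\<rho> = Sup subcritical"

lemma monomial_le_\<Phi>: "e \<in> E \<Longrightarrow> x \<ge> 0 \<Longrightarrow> w \<ge> 0 \<Longrightarrow> x ^ \<alpha> e * w ^ \<beta> e \<le> \<Phi> x w"
  unfolding \<Phi>_def using finite_E by (intro member_le_sum) auto

lemma psum_le_\<Phi>: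
  assumes "x \<ge> 0" shows "psum f N x \<le> \<Phi> x (psum f N x)"
proof -
  have "psum (\<Sum>e\<in>E. fps_X ^ \<alpha> e * f ^ \<beta> e) N x = (\<Sum>e\<in>E. psum (fps_X ^ \<alpha> e * f ^ \<beta> e) N x)"
    unfolding psum_def fps_sum_nth sum_distrib_right by (rule sum.swap)
  also have "\<dots> \<le> \<Phi> x (psum f N x)"
    unfolding \<Phi>_def
  proof (rule sum_mono)
    fix e
    have "psum (fps_X ^ \<alpha> e * f ^ \<beta> e) N x \<le> psum (fps_X ^ \<alpha> e) N x * psum (f ^ \<beta> e) N x"
      using assms f_nonneg by (intro psum_mult_le nonneg_power nonneg_X)
    also have "\<dots> \<le> psum fps_X N x ^ \<alpha> e * psum f N x ^ \<beta> e"
      using assms f_nonneg by (intro mult_mono psum_power_le psum_nonneg nonneg_power nonneg_X zero_le_power)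
    also have "\<dots> \<le> x ^ \<alpha> e * psum f N x ^ \<beta> e"
      using assms f_nonneg by (intro mult_right_mono power_mono psum_X_le psum_nonneg nonneg_X zero_le_power)
    finally show "psum (fps_X ^ \<alpha> e * f ^ \<beta> e) N x \<le> x ^ \<alpha> e * psum f N x ^ \<beta> e" .
  qed
  finally show ?thesis using f_eq by simp
qed

text \<open>\<open>\<Phi> x w\<close> contains a pure power of \<open>w\<close> of degree at least
  \<open>2\<close>, which exceeds \<open>w\<close> as soon as \<open>w > 1\<close>.\<close>

lemma fixed_le_1:
  assumes "x \<ge> 0" "w \<ge> 0" "\<Phi> x w \<le> w" shows "w \<le> 1"
proof (rule ccontr)
  assume "\<not> w \<le> 1"
  obtain e where e: "e \<in> E" "\<alpha> e = 0" using branching by blast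
  have "w ^ 1 < w ^ \<beta> e" using \<open>\<not> w \<le> 1\<close> no_constant[OF e] by (intro power_strict_increasing) auto
  then show False using monomial_le_\<Phi>[OF e(1) assms(1,2)] assms(3) e(2) by simp
qed

lemma subcritical_le_1:
  assumes "x \<in> subcritical" shows "x \<le> 1"
proof -
  obtain w where w: "x \<ge> 0" "w \<ge> 0" "\<Phi> x w \<le> w" using assms by (auto simp: subcritical_def)
  obtain e where e: "e \<in> E" "\<alpha> e = 1" "\<beta> e = 0" using leaf by blast
  show ?thesis using monomial_le_\<Phi>[OF e(1) w(1,2)] w(3) fixed_le_1[OF w] e by simp
qed

lemma bdd_above_subcritical: "bdd_above subcritical"
  by (rule bdd_aboveI[where M = 1]) (rule subcritical_le_1)

lemma isCont_\<Phi>: "isCont (\<lambda>x. \<Phi> x w) x"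
  unfolding \<Phi>_def by (intro continuous_intros)

text \<open>The same \<open>w\<close> remains a witness for slightly larger \<open>x\<close>. At
  \<open>x = 0\<close> this gives \<open>\<rho> > 0\<close>, at \<open>x = \<rho>\<close> it gives
  \<open>\<Phi>_ge\<close>.\<close>

lemma subcritical_extend:
  assumes "x \<ge> 0" "w \<ge> 0" "\<Phi> x w < w"
  obtains y where "y > x" "y \<in> subcritical"
proof -
  have "\<forall>\<^sub>F y in at x. \<Phi> y w < w"
    using isCont_\<Phi>[where x = x and w = w] assms(3) unfolding isCont_def by (rule order_tendstoD(2))
  then obtain d where d: "d > 0" "\<And>y. y \<noteq> x \<Longrightarrow> dist y x < d \<Longrightarrow> \<Phi> y w < w"
    unfolding eventually_at by auto
  have "\<Phi> (x + d / 2) w < w" using d by (intro d(2)) (auto simp: dist_real_def)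
  then have "x + d / 2 \<in> subcritical"
    using d(1) assms less_imp_le by (fastforce simp: subcritical_def)
  then show ?thesis using that[of "x + d / 2"] d(1) by simp
qed

lemma \<rho>_pos: "\<rho> > 0"
proof -
  \<comment> \<open>Each monomial of \<open>\<Phi> 0 w\<close> is at most \<open>w ^ 2\<close>, so
    their sum is at most \<open>card E * w ^ 2 = w / 2\<close>.\<close>
  define w where "w = 1 / (2 * real (card E))"
  have E: "real (card E) \<ge> 1" using finite_E leaf by (auto simp: Suc_le_eq card_gt_0_iff)
  then have w: "w > 0" "w \<le> 1" by (auto simp: w_def field_simps)
  have "\<Phi> 0 w \<le> (\<Sum>e\<in>E. w ^ 2)"
    unfolding \<Phi>_def
  proof (rule sum_mono)
    fix e assume e: "e \<in> E"
    show "0 ^ \<alpha> e * w ^ \<beta> e \<le> w ^ 2"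
    proof (cases "\<alpha> e = 0")
      case True
      then show ?thesis using no_constant[OF e True] w by (simp add: power_decreasing)
    next
      case False
      then show ?thesis using w by (simp add: power_0_left)
    qed
  qed
  also have "\<dots> < w" using E by (simp add: w_def power2_eq_square field_simps)
  finally obtain y where "y > 0" "y \<in> subcritical" using subcritical_extend[of 0 w] w by auto
  then show ?thesis
    unfolding \<rho>_def using cSup_upper[OF _ bdd_above_subcritical, of y] by linarith
qed

lemma psum_bound:
  assumes "0 \<le> x" "x < \<rho>" shows "psum f N x \<le> 1"
proof -
  have "\<Phi> 0 0 = 0"
    unfolding \<Phi>_def
  proof (rule sum.neutral, rule ballI)
    fix e assume "e \<in> E"
    then show "(0 :: real) ^ \<alpha> e * 0 ^ \<beta> e = 0"
      using no_constant[of e] by (cases "\<alpha> e = 0") auto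
  qed
  then have "0 \<in> subcritical" by (auto simp: subcritical_def)
  then obtain y where y: "x < y" "y \<in> subcritical"
    using assms(2) less_cSupD[of subcritical x] unfolding \<rho>_def by blast
  then obtain w where w: "w \<ge> 0" "\<Phi> y w \<le> w" by (auto simp: subcritical_def)
  obtain e where e: "e \<in> E" "\<alpha> e = 1" "\<beta> e = 0" using leaf by blast
  have strict: "\<Phi> u w < \<Phi> y w" if "0 \<le> u" "u < y" for u
    unfolding \<Phi>_def
  proof (rule sum_strict_mono_ex1[OF finite_E])
    show "\<forall>e\<in>E. u ^ \<alpha> e * w ^ \<beta> e \<le> y ^ \<alpha> e * w ^ \<beta> e"
      using that w by (intro ballI mult_right_mono power_mono) auto
    show "\<exists>e\<in>E. u ^ \<alpha> e * w ^ \<beta> e < y ^ \<alpha> e * w ^ \<beta> e"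
      using e that by (intro bexI[of _ e]) auto
  qed
  \<comment> \<open>The partial sum starts at \<open>0\<close> and cannot cross \<open>w\<close>, because \<open>w \<le> \<Phi>(u, w) < \<Phi>(y, w) \<le> w\<close>
    at a crossing \<open>u\<close>.\<close>
  have "psum f N x \<le> w"
  proof (rule ccontr)
    assume "\<not> psum f N x \<le> w"
    moreover have "psum f N 0 = 0"
      unfolding psum_def using f_0 by (intro sum.neutral) (auto simp: power_0_left)
    moreover have "continuous_on {0..x} (psum f N)"
      unfolding psum_def by (intro continuous_intros)
    ultimately obtain u where u: "0 \<le> u" "u \<le> x" "psum f N u = w"
      using IVT'[of "psum f N" 0 w x] assms w by auto
    then have "w \<le> \<Phi> u w" using psum_le_\<Phi>[of u N] by simp
    then show False using strict[of u] u y w by simp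
  qed
  also have "w \<le> 1" using fixed_le_1[of y w] y w assms by simp
  finally show ?thesis .
qed

text \<open>The supremum is not yet known to be attained, so the bound is carried over from smaller
  \<open>x\<close> by continuity.\<close>

lemma psum_bound_\<rho>: "psum f N \<rho> \<le> 1"
proof (rule tendsto_upperbound)
  have "isCont (psum f N) \<rho>" unfolding psum_def by (intro continuous_intros)
  then show "(psum f N \<longlongrightarrow> psum f N \<rho>) (at_left \<rho>)"
    unfolding isCont_def using tendsto_within_subset by blast
  show "\<forall>\<^sub>F x in at_left \<rho>. psum f N x \<le> 1"
    using eventually_at_left_real[OF \<rho>_pos] by eventually_elim (auto intro: psum_bound)
qed simp

lemma summable_f: "summable (\<lambda>k. f $ k * \<rho> ^ k)"
proof (rule summableI_nonneg_bounded)
  show "0 \<le> f $ k * \<rho> ^ k" for k using f_nonneg \<rho>_pos by (simp add: nonneg_def)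
  show "(\<Sum>k<n. f $ k * \<rho> ^ k) \<le> 1" for n
  proof (cases n)
    case (Suc m)
    then show ?thesis using psum_bound_\<rho>[of m] by (simp add: psum_def lessThan_Suc_atMost)
  qed simp
qed

lemma abs_conv_f: "norm z \<le> \<rho> \<Longrightarrow> abs_conv z f"
  unfolding abs_conv_def
  by (rule summable_comparison_test'[OF summable_f, where N = 0])
    (use f_nonneg in \<open>auto simp: nonneg_def norm_mult norm_power intro!: mult_left_mono power_mono\<close>)

lemma ev_f: assumes "norm z \<le> \<rho>" shows "ev z f = (\<Sum>e\<in>E. z ^ \<alpha> e * ev z f ^ \<beta> e)"
proof -
  have m: "abs_conv z (fps_X ^ \<alpha> e * f ^ \<beta> e)" "ev z (fps_X ^ \<alpha> e * f ^ \<beta> e) = z ^ \<alpha> e * ev z f ^ \<beta> e" for e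
    using ev_mult[of z "fps_X ^ \<alpha> e" "f ^ \<beta> e"] ev_power[OF ev_X(1), of z "\<alpha> e"]
      ev_power[OF abs_conv_f[OF assms], of "\<beta> e"] ev_X(2) by simp_all
  have "ev z f = ev z (\<Sum>e\<in>E. fps_X ^ \<alpha> e * f ^ \<beta> e)" using f_eq by simp
  also have "\<dots> = (\<Sum>e\<in>E. z ^ \<alpha> e * ev z f ^ \<beta> e)" unfolding ev_sum[OF m(1)] m(2) ..
  finally show ?thesis .
qed

definition \<tau> :: real where "\<tau> = (\<Sum>k. f $ k * \<rho> ^ k)"

text \<open>As \<open>\<tau>\<close> is nonnegative, this makes \<open>\<rho>\<close> itself
  subcritical: the supremum is attained.\<close>

lemma \<Phi>_\<tau>: "\<Phi> \<rho> \<tau> = \<tau>"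
proof -
  have ev: "ev (of_real \<rho>) f = of_real \<tau>"
    unfolding ev_def \<tau>_def using suminf_of_real[OF summable_f, where 'a = complex] by simp
  have "of_real \<tau> = (\<Sum>e\<in>E. of_real \<rho> ^ \<alpha> e * of_real \<tau> ^ \<beta> e :: complex)"
    using ev_f[of "of_real \<rho>"] \<rho>_pos unfolding ev by simp
  then have "complex_of_real \<tau> = of_real (\<Phi> \<rho> \<tau>)" by (simp add: \<Phi>_def)
  then show ?thesis by (simp only: of_real_eq_iff)
qed

lemma \<tau>_pos: "\<tau> > 0"
proof -
  have "\<tau> \<ge> 0" unfolding \<tau>_def using f_nonneg \<rho>_pos
    by (intro suminf_nonneg summable_f) (auto simp: nonneg_def)
  moreover obtain e where "e \<in> E" "\<alpha> e = 1" "\<beta> e = 0" using leaf by blast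
  ultimately show ?thesis using monomial_le_\<Phi>[of e \<rho> \<tau>] \<rho>_pos \<Phi>_\<tau> by simp
qed

lemma \<Phi>_ge: assumes "w \<ge> 0" shows "\<Phi> \<rho> w \<ge> w"
proof (rule ccontr)
  assume "\<not> \<Phi> \<rho> w \<ge> w"
  then obtain y where "y > \<rho>" "y \<in> subcritical"
    using subcritical_extend[of \<rho> w] \<rho>_pos assms by auto
  then show False unfolding \<rho>_def using cSup_upper[OF _ bdd_above_subcritical, of y] by linarith
qed

lemma critical: "(\<Sum>e\<in>E. \<rho> ^ \<alpha> e * real (\<beta> e) * \<tau> ^ (\<beta> e - 1)) = 1"
proof -
  have "((\<lambda>w. \<Phi> \<rho> w - w) has_real_derivative
      (\<Sum>e\<in>E. \<rho> ^ \<alpha> e * (real (\<beta> e) * \<tau> ^ (\<beta> e - 1))) - 1) (at \<tau>)"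
    unfolding \<Phi>_def by (auto intro!: derivative_eq_intros simp: mult_ac)
  \<comment> \<open>The radius \<open>\<tau>\<close> keeps \<open>y\<close> positive, where
    \<open>\<Phi>_ge\<close> applies; thus \<open>\<tau>\<close> is an interior minimum.\<close>
  moreover have "\<forall>y. \<bar>\<tau> - y\<bar> < \<tau> \<longrightarrow> \<Phi> \<rho> \<tau> - \<tau> \<le> \<Phi> \<rho> y - y"
    using \<Phi>_ge by (auto simp: \<Phi>_\<tau>)
  ultimately have "(\<Sum>e\<in>E. \<rho> ^ \<alpha> e * (real (\<beta> e) * \<tau> ^ (\<beta> e - 1))) - 1 = 0"
    using DERIV_local_min[OF _ \<tau>_pos] by blast
  then show ?thesis by (simp add: mult.assoc)
qed

text \<open>Each member of \<open>M\<close> contributes exactly \<open>\<rho>\<close> to the sum in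
  \<open>critical\<close>; strictness comes from the positive contribution of the
  \<open>branching\<close> monomial.\<close>

lemma card_unary_less:
  assumes M: "M \<subseteq> E" "\<And>e. e \<in> M \<Longrightarrow> \<alpha> e = 1 \<and> \<beta> e = 1"
  shows "real (card M) < 1 / \<rho>"
proof -
  let ?t = "\<lambda>e. \<rho> ^ \<alpha> e * real (\<beta> e) * \<tau> ^ (\<beta> e - 1)"
  obtain e where e: "e \<in> E" "\<alpha> e = 0" using branching by blast
  have "e \<notin> M" using M(2) e(2) by force
  have fin: "finite M" using M(1) finite_E finite_subset by blast
  have "real (card M) * \<rho> = (\<Sum>e\<in>M. ?t e)" using M(2) by simp
  also have "\<dots> < ?t e + (\<Sum>e\<in>M. ?t e)" using no_constant[OF e] e(2) \<tau>_pos by simp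
  also have "\<dots> = (\<Sum>e\<in>insert e M. ?t e)" using \<open>e \<notin> M\<close> fin by simp
  also have "\<dots> \<le> (\<Sum>e\<in>E. ?t e)"
    using \<rho>_pos \<tau>_pos M(1) e(1) finite_E by (intro sum_mono2) auto
  finally show ?thesis unfolding critical using \<rho>_pos by (simp add: field_simps)
qed

sublocale normalised: critical_system E "\<lambda>e. \<rho> ^ \<alpha> e" \<alpha> \<beta> "\<lambda>k. f $ k * \<rho> ^ k"
  "\<lambda>z. \<Sum>k. of_real (f $ k * \<rho> ^ k) * z ^ k" "suminf (\<lambda>k. f $ k * \<rho> ^ k)"
proof unfold_locales
  show "finite E" by (rule finite_E)
  show "\<rho> ^ \<alpha> e \<ge> 0" for e using \<rho>_pos by simp
  show "f $ k * \<rho> ^ k \<ge> 0" for k using \<rho>_pos f_nonneg by (simp add: nonneg_def)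
  show "summable (\<lambda>k. f $ k * \<rho> ^ k)" by (rule summable_f)
  show "(\<Sum>e\<in>E. \<rho> ^ \<alpha> e * real (\<beta> e) * suminf (\<lambda>k. f $ k * \<rho> ^ k) ^ (\<beta> e - 1)) = 1"
    using critical by (simp add: \<tau>_def)
  show "suminf (\<lambda>k. f $ k * \<rho> ^ k) > 0" using \<tau>_pos by (simp add: \<tau>_def)
  show "\<exists>e\<in>E. \<rho> ^ \<alpha> e > 0 \<and> \<alpha> e = 1 \<and> \<beta> e = 1" using unary \<rho>_pos by auto
  show "\<exists>e\<in>E. \<rho> ^ \<alpha> e > 0 \<and> \<beta> e \<ge> 2" using branching no_constant \<rho>_pos by auto
  fix z :: complex assume z: "norm z \<le> 1"
  have eq: "(\<Sum>k. of_real (f $ k * \<rho> ^ k) * z ^ k) = ev (of_real \<rho> * z) f"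
    by (simp add: ev_def power_mult_distrib mult_ac)
  have "norm (of_real \<rho> * z) \<le> \<rho>" using z \<rho>_pos by (simp add: norm_mult mult_left_le)
  from ev_f[OF this] show "(\<Sum>k. of_real (f $ k * \<rho> ^ k) * z ^ k) =
      (\<Sum>e\<in>E. of_real (\<rho> ^ \<alpha> e) * z ^ \<alpha> e * (\<Sum>k. of_real (f $ k * \<rho> ^ k) * z ^ k) ^ \<beta> e)"
    unfolding eq by (simp add: power_mult_distrib)
qed

theorem coeff_bigtheta: "(\<lambda>k. f $ k) \<in> \<Theta>(\<lambda>k. (1 / \<rho>) ^ k * real k powr (- 3/2))"
proof -
  obtain L where L: "L > 0" "(\<lambda>k. f $ k * \<rho> ^ k * real k powr (3/2)) \<longlonglongrightarrow> L"
    by (rule normalised.coeff_asymp)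
  have eq: "f $ k / ((1 / \<rho>) ^ k * real k powr (- 3/2)) = f $ k * \<rho> ^ k * real k powr (3/2)" for k
  proof -
    have "real k powr (- 3/2) = inverse (real k powr (3/2))"
      using powr_minus[of "real k" "3/2"] by simp
    then show ?thesis
      by (simp only: divide_inverse mult_1_left inverse_mult_distrib power_inverse inverse_inverse_eq mult.assoc)
  qed
  show ?thesis
  proof (rule bigthetaI_tendsto[where c = L])
    show "L \<noteq> 0" using L(1) by simp
    show "(\<lambda>k. f $ k / ((1 / \<rho>) ^ k * real k powr (- 3/2))) \<longlonglongrightarrow> L"
      unfolding eq by (rule L(2))
  qed
qed

end

theorem theorem3:
  fixes n :: nat
  assumes "n \<ge> 2"
  shows "\<exists>D::real. D > real n \<and>
    (\<lambda>k. real (num_lower_dsc n k)) \<in> \<Theta>(\<lambda>k. D ^ k * real k powr (-3/2))"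
proof -
  let ?\<beta> = "\<lambda>Q. card ({..<n} - \<Union>Q)"
  \<comment> \<open>All children but \<open>i\<close> in a single block: these are the
    \<open>n\<close> monomials \<open>z w\<close>. The block is nonempty because
    \<open>n \<ge> 2\<close>.\<close>
  have unary_mem: "{{..<n} - {i}} \<in> level_one n" if "i < n" for i
  proof -
    have "(if i = 0 then 1 else 0) \<in> {..<n} - {i}" using assms that by auto
    then have "{..<n} - {i} \<noteq> {}" by blast
    then show ?thesis by (auto simp: level_one_def)
  qed
  have unary_card: "card {{..<n} - {i}} = 1 \<and> ?\<beta> {{..<n} - {i}} = 1" if "i < n" for i
  proof -
    have "{..<n} - \<Union>{{..<n} - {i}} = {i}" using that by auto
    then show ?thesis by (simp only: card_1_singleton_iff) auto
  qed
  interpret monomial_system "level_one n" card ?\<beta> "dsc_fps n"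
  proof
    show "finite (level_one n)" by (rule finite_level_one)
    show "nonneg (dsc_fps n)" by (simp add: nonneg_def dsc_fps_def)
    show "dsc_fps n $ 0 = 0" by (rule dsc_fps_0)
    show "dsc_fps n = (\<Sum>Q\<in>level_one n. fps_X ^ card Q * dsc_fps n ^ ?\<beta> Q)"
      by (rule dsc_fps_recursion[OF assms])
    \<comment> \<open>Without blocks \<open>Q\<close> is empty and all \<open>n\<close> children
      stay uncoloured: the monomial \<open>w ^ n\<close>.\<close>
    show "?\<beta> Q \<ge> 2" if "Q \<in> level_one n" "card Q = 0" for Q
      using that level_one_memD(1)[OF that(1)] assms by simp
    have "0 \<in> {..<n}" using assms by simp
    then have "{..<n} \<noteq> {}" by blast
    \<comment> \<open>One block of all children leaves no free subtree: the monomial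
      \<open>z\<close>.\<close>
    then have "{{..<n}} \<in> level_one n" by (auto simp: level_one_def)
    then show "\<exists>Q\<in>level_one n. card Q = 1 \<and> ?\<beta> Q = 0" by (rule bexI[rotated]) simp
    show "\<exists>Q\<in>level_one n. card Q = 1 \<and> ?\<beta> Q = 1"
      using unary_mem[of 0] unary_card[of 0] assms by (intro bexI[of _ "{{..<n} - {0}}"]) simp_all
    show "\<exists>Q\<in>level_one n. card Q = 0" by (intro bexI[of _ "{}"]) (auto simp: level_one_def)
  qed
  let ?M = "(\<lambda>i. {{..<n} - {i}}) ` {..<n}"
  have "card ?M = n"
  proof -
    have "inj_on (\<lambda>i. {{..<n} - {i}}) {..<n}" by (rule inj_onI) auto
    then show ?thesis by (simp add: card_image)
  qed
  moreover have "real (card ?M) < 1 / \<rho>"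
    by (rule card_unary_less) (use unary_mem unary_card in auto)
  moreover have "(\<lambda>k. real (num_lower_dsc n k)) \<in> \<Theta>(\<lambda>k. (1 / \<rho>) ^ k * real k powr (-3/2))"
    using coeff_bigtheta by (simp add: dsc_fps_def)
  ultimately show ?thesis by (intro exI[of _ "1 / \<rho>"]) simp
qed

end
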